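(* Let $n,n_u,n_v,n_w,n_\eta$ be positive integers and consider the coupled PDE/ODE system, for $t\ge 0$, $z\in[0,1]$, $$\partial_t \xi(t,z) = -\Lambda\,\partial_z\xi(t,z),\qquad \xi(t,0)=H\xi(t,1)+B_uu(t)+B_vv(t),$$ $$\dot v(t)=Mv(t)+B_ww(t),\qquad y(t)=\xi(t,1)+D_vv(t),$$ $$u(t)=K_1\eta(t)+K_2y(t),\qquad \dot\eta(t)=R\eta(t)+Sy(t),$$ with $\xi(t,z)\in\mathbb{R}^n$, $v\in\mathbb{R}^{n_v}$, $w\in\mathbb{R}^{n_w}$, $\eta\in\mathbb{R}^{n_\eta}$, $y\in\mathbb{R}^n$, $u\in\mathbb{R}^{n_u}$, where $\Lambda,H,B_u,B_v,M,B_w,D_v,K_1,K_2,R,S$ are given real matrices of appropriate dimensions, $\Lambda$ is diagonal positive definite and $M$ is Hurwitz. Suppose that the disturbance $w$ belongs to $$\mathcal{W}:=\{w\in (L^2(0,\infty))^{n_w} : w(t)^\top w(t)\le 1\}.$$ Let $\lambda$ be the smallest eigenvalue of $\Lambda$ and let $\alpha,\beta>0$ be given scalars with $$2\alpha+\beta\le e^{-1}\lambda .$$ Suppose there exist positive definite matrices $P_1\in\mathbb{D}^n$, $P_2\in\mathbb{D}^n$, $P_3\in\mathbb{S}^{n_\eta}$, $P_4\in\mathbb{S}^{n_v}$ such that $$\begin{bmatrix}\Psi_a & \star & \star\\ P_1\Lambda\Phi_a & -P_1\Lambda & \star\\ P_2\Phi_b & 0 & -P_2\Lambda\end{bmatrix}<0,$$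 where $$\Phi_a:=\begin{bmatrix}0 & H+B_uK_2 & B_uK_1 & B_v+B_uK_2D_v & 0\end{bmatrix},$$ $$\Phi_b:=\begin{bmatrix}(H+B_uK_2)\Lambda & -B_uK_1S & -B_uK_1R & -(B_vM+B_uK_1SD_v+B_uK_2D_vM) & -B_vB_w\end{bmatrix},$$ and $\Psi_a=[\psi_{ij}]_{i,j=1,\dots,5}$ is the symmetric block matrix ($\psi_{ij}=\psi_{ji}^\top$), with block sizes $n,n,n_\eta,n_v,n_w$, given with $\vartheta:=\alpha+0.5\beta$ by $$\psi_{11}=-e^{-1}\Lambda P_2,\quad \psi_{22}=-e^{-1}\Lambda P_1,\quad \psi_{32}=P_3S,\quad \psi_{33}=\mathrm{He}\{P_3R+\vartheta P_3\},\quad \psi_{34}=P_3SD_v,$$ $$\psi_{44}=\mathrm{He}\{P_4M+\vartheta P_4\},\quad \psi_{45}=P_4B_w,\quad \psi_{55}=-\beta I_{n_w},$$ all blocks not determined by these (and symmetry) being zero. Then the coupled system is (exponentially) ISS with respect to $\mathcal{W}$. Moreover, the set $$\mathcal{R}:=\{(\xi,\partial_z\xi,v,\eta)\in \mathcal{L}_2^n\times\mathcal{L}_2^n\times\mathbb{R}^{n_v}\times\mathbb{R}^{n_\eta} : V(\xi,\partial_z\xi,v,\eta)\le 1\},$$ with $$V=\int_0^1 e^{-z}\xi^\top P_1\xi\,dz+\int_0^1 e^{-z}(\partial_z\xi)^\top P_2\,\partial_z\xi\,dz+\eta^\top P_3\eta+v^\top P_4v,$$ is an estimate of the system's ultimate-bound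 set, i.e. for all compatible initial conditions and all $w\in\mathcal{W}$ the state trajectory converges to $\mathcal{R}$ as $t\to\infty$.
   Context: Notation: $\mathbb{S}^m$ and $\mathbb{D}^m$ are the spaces of $m\times m$ real symmetric and real diagonal matrices; $\mathrm{He}\{W\}:=W+W^\top$; $\star$ denotes a block deduced by symmetry; $<0$ means negative definite. $\mathcal{L}_2^n$ is the space of square integrable functions $[0,1]\to\mathbb{R}^n$ with norm $\|z\|_{\mathcal{L}_2}=(\int_0^1 z(x)^\top z(x)\,dx)^{1/2}$. For a signal $s:\mathbb{R}_+\to\mathbb{R}^m$, $\|s\|_\infty:=(\sup_{t\ge0}s(t)^\top s(t))^{1/2}$. Initial conditions: $\xi(0,z)=\xi_0(z)$, $v(0)=v_0$, $\eta(0)=\eta_0$ with $\xi_0\in C^1([0,1];\mathbb{R}^n)$, $v_0\in\mathbb{R}^{n_v}$, $\eta_0\in\mathbb{R}^{n_\eta}$ satisfying the first-order compatibility conditions (the boundary condition, and its time derivative computed through the system equations, hold at $t=0$); such initial conditions are called compatible. Solutions are considered in the $H^1$ sense in $z$. Norm: $\|(\xi,v,\eta)\|_X:=\|\xi\|_{\mathcal{L}_2}+\|\partial_z\xi\|_{\mathcal{L}_2}+\|v\|_2+\|\eta\|_2$ (the system's $H_1$-norm). Definition (exponential ISS): the coupled system is (exponentially) ISS with respect to $w\in\mathcal{W}$ if there exist positive scalars $a,\rho,\varrho$ such that its solutions satisfy $$\|(\xi(t,\cdot),v(t),\eta(t))\|_X\le \rho e^{-at}\|(\xi_0,v_0,\eta_0)\|_X+\varrho\|w\|_\infty\qquad\forall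 t\ge0 .$$ The ultimate-bound set associated with such constants is $\{(\xi,\partial_z\xi,v,\eta):\|(\xi,v,\eta)\|_X^2\le\varrho\}$; the phrase "$\mathcal{R}$ is an estimate of the ultimate-bound set" means that trajectories from compatible initial conditions converge to $\mathcal{R}$ as $t\to\infty$. *)

theory Defs
  imports "HOL-Analysis.Analysis"
begin

definition diagonal_matrix :: "real^'n^'n \<Rightarrow> bool" where
  "diagonal_matrix A \<longleftrightarrow> (\<forall>i j. i \<noteq> j \<longrightarrow> A $ i $ j = 0)"

definition pos_def :: "real^'n^'n \<Rightarrow> bool" where
  "pos_def A \<longleftrightarrow> transpose A = A \<and> (\<forall>x. x \<noteq> 0 \<longrightarrow> 0 < x \<bullet> (A *v x))"

definition neg_def :: "real^'n^'n \<Rightarrow> bool" where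
  "neg_def A \<longleftrightarrow> transpose A = A \<and> (\<forall>x. x \<noteq> 0 \<longrightarrow> x \<bullet> (A *v x) < 0)"

definition He :: "real^'n^'n \<Rightarrow> real^'n^'n" where
  "He W = W + transpose W"

definition is_eigenvalue :: "'a::field^'n^'n \<Rightarrow> 'a \<Rightarrow> bool" where
  "is_eigenvalue A k \<longleftrightarrow> (\<exists>x. x \<noteq> 0 \<and> A *v x = k *s x)"

definition is_smallest_eigenvalue :: "real^'n^'n \<Rightarrow> real \<Rightarrow> bool" where
  "is_smallest_eigenvalue A k \<longleftrightarrow> is_eigenvalue A k \<and> (\<forall>l. is_eigenvalue A l \<longrightarrow> k \<le> l)"

definition hurwitz :: "real^'n^'n \<Rightarrow> bool" where
  "hurwitz A \<longleftrightarrow>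
     (\<forall>k. is_eigenvalue (\<chi> i j. complex_of_real (A $ i $ j)) k \<longrightarrow> Re k < 0)"

text \<open>Block matrices are indexed by sum types: \<open>A ||| B\<close> puts the blocks next to each other,
  \<open>A --- B\<close> puts \<open>A\<close> on top of \<open>B\<close>.\<close>

definition block_row :: "real^'a^'m \<Rightarrow> real^'b^'m \<Rightarrow> real^('a + 'b)^'m" (infixr "|||" 60) where
  "A ||| B = (\<chi> i j. case j of Inl a \<Rightarrow> A $ i $ a | Inr b \<Rightarrow> B $ i $ b)"

definition block_col :: "real^'m^'a \<Rightarrow> real^'m^'b \<Rightarrow> real^'m^('a + 'b)" (infixr "---" 55) where
  "A --- B = (\<chi> i. case i of Inl a \<Rightarrow> A $ a | Inr b \<Rightarrow> B $ b)"

definition square_integrable :: "real set \<Rightarrow> (real \<Rightarrow> 'a::euclidean_space) \<Rightarrow> bool" where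
  "square_integrable A f \<longleftrightarrow>
     set_borel_measurable lebesgue A f \<and> set_integrable lebesgue A (\<lambda>x. f x \<bullet> f x)"

definition L2_norm :: "(real \<Rightarrow> 'a::euclidean_space) \<Rightarrow> real" where
  "L2_norm f = sqrt (LINT z:{0..1}|lebesgue. f z \<bullet> f z)"

text \<open>\<open>f\<close> is the continuous representative of an \<open>H\<^sup>1\<close> function on \<open>[0,1]\<close>, and \<open>g\<close> represents its
  weak derivative.\<close>

definition H1_deriv :: "(real \<Rightarrow> 'a::euclidean_space) \<Rightarrow> (real \<Rightarrow> 'a) \<Rightarrow> bool" where
  "H1_deriv f g \<longleftrightarrow>
     square_integrable {0..1} f \<and> square_integrable {0..1} g \<and>
     (\<forall>z\<in>{0..1}. (g has_integral (f z - f 0)) {0..z})"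

definition C1_deriv :: "(real \<Rightarrow> 'a::euclidean_space) \<Rightarrow> (real \<Rightarrow> 'a) \<Rightarrow> bool" where
  "C1_deriv f g \<longleftrightarrow>
     (\<forall>z\<in>{0..1}. (f has_vector_derivative g z) (at z within {0..1})) \<and> continuous_on {0..1} g"

definition X_norm ::
    "(real \<Rightarrow> real^'n) \<Rightarrow> (real \<Rightarrow> real^'n) \<Rightarrow> real^'v \<Rightarrow> real^'e \<Rightarrow> real" where
  "X_norm \<xi> \<xi>z v \<eta> = L2_norm \<xi> + L2_norm \<xi>z + norm v + norm \<eta>"

text \<open>Only meaningful for signals bounded on \<open>[0,\<infinity>)\<close>, since \<^const>\<open>Sup\<close> of an unbounded set of
  reals is unspecified.\<close>

definition sup_norm :: "(real \<Rightarrow> real^'m) \<Rightarrow> real" where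
  "sup_norm s = sqrt (SUP t\<in>{0..}. s t \<bullet> s t)"

definition disturbances :: "(real \<Rightarrow> real^'w) set" where
  "disturbances = {w. square_integrable {0<..} w \<and> (\<forall>t\<ge>0. w t \<bullet> w t \<le> 1)}"

locale coupled_system =
  fixes \<Lambda> :: "real^'n^'n"
    and H :: "real^'n^'n"
    and Bu :: "real^'u^'n"
    and Bv :: "real^'v^'n"
    and M :: "real^'v^'v"
    and Bw :: "real^'w^'v"
    and Dv :: "real^'v^'n"
    and K1 :: "real^'e^'u"
    and K2 :: "real^'n^'u"
    and R :: "real^'e^'e"
    and S :: "real^'n^'e"
begin

text \<open>Solutions lie in \<open>C([0,\<infinity>); H\<^sup>1) \<inter> C\<^sup>1([0,\<infinity>); L\<^sup>2)\<close>: \<open>\<xi>z t\<close> is the derivative of \<open>\<xi> t\<close> in space,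
  and the transport equation says that the \<open>L\<^sup>2\<close>-limit of the time difference quotients of \<open>\<xi>\<close>
  is \<open>- \<Lambda> \<xi>z\<close>. As \<open>w\<close> is merely measurable, the equation for \<open>v\<close> holds in Caratheodory's sense, i.e.
  in integrated form. Time derivatives at \<open>t = 0\<close> are one-sided.\<close>

definition is_solution ::
    "(real \<Rightarrow> real^'w) \<Rightarrow> (real \<Rightarrow> real \<Rightarrow> real^'n) \<Rightarrow> (real \<Rightarrow> real \<Rightarrow> real^'n) \<Rightarrow>
     (real \<Rightarrow> real^'v) \<Rightarrow> (real \<Rightarrow> real^'e) \<Rightarrow> bool" where
  "is_solution w \<xi> \<xi>z v \<eta> \<longleftrightarrow>
     (let y = (\<lambda>t. \<xi> t 1 + Dv *v v t);
          u = (\<lambda>t. K1 *v \<eta> t + K2 *v y t)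
      in (\<forall>t\<ge>0. H1_deriv (\<xi> t) (\<xi>z t)) \<and>
         (\<forall>t\<ge>0. ((\<lambda>s. L2_norm (\<lambda>z. \<xi> s z - \<xi> t z)) \<longlongrightarrow> 0) (at t within {0..})) \<and>
         (\<forall>t\<ge>0. ((\<lambda>s. L2_norm (\<lambda>z. \<xi>z s z - \<xi>z t z)) \<longlongrightarrow> 0) (at t within {0..})) \<and>
         (\<forall>t\<ge>0. ((\<lambda>s. L2_norm (\<lambda>z. (1 / (s - t)) *\<^sub>R (\<xi> s z - \<xi> t z) - (- (\<Lambda> *v \<xi>z t z))))
                    \<longlongrightarrow> 0) (at t within {0..})) \<and>
         (\<forall>t\<ge>0. \<xi> t 0 = H *v \<xi> t 1 + Bu *v u t + Bv *v v t) \<and>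
         (\<forall>t\<ge>0. ((\<lambda>s. M *v v s + Bw *v w s) has_integral (v t - v 0)) {0..t}) \<and>
         (\<forall>t\<ge>0. (\<eta> has_vector_derivative (R *v \<eta> t + S *v y t)) (at t within {0..})))"

text \<open>First-order compatibility at \<open>t = 0\<close>; the \<open>dot\<close> variables are the time derivatives at \<open>t = 0\<close>
  given by the system equations, and \<open>w0\<close> is the initial value of the disturbance.\<close>

definition compatible :: "real^'w \<Rightarrow> (real \<Rightarrow> real^'n) \<Rightarrow> real^'v \<Rightarrow> real^'e \<Rightarrow> bool" where
  "compatible w0 \<xi>0 v0 \<eta>0 \<longleftrightarrow>
     (\<exists>\<xi>0'. C1_deriv \<xi>0 \<xi>0' \<and>
       (let y0 = \<xi>0 1 + Dv *v v0;
            u0 = K1 *v \<eta>0 + K2 *v y0;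
            \<xi>dot = (\<lambda>z. - (\<Lambda> *v \<xi>0' z));
            vdot = M *v v0 + Bw *v w0;
            \<eta>dot = R *v \<eta>0 + S *v y0;
            ydot = \<xi>dot 1 + Dv *v vdot;
            udot = K1 *v \<eta>dot + K2 *v ydot
        in \<xi>0 0 = H *v \<xi>0 1 + Bu *v u0 + Bv *v v0 \<and>
           \<xi>dot 0 = H *v \<xi>dot 1 + Bu *v udot + Bv *v vdot))"

definition exp_ISS :: "(real \<Rightarrow> real^'w) set \<Rightarrow> bool" where
  "exp_ISS W \<longleftrightarrow>
     (\<exists>a>0. \<exists>\<rho>>0. \<exists>\<sigma>>0. \<forall>w\<in>W. \<forall>\<xi> \<xi>z v \<eta>.
        is_solution w \<xi> \<xi>z v \<eta> \<and> compatible (w 0) (\<xi> 0) (v 0) (\<eta> 0) \<longrightarrow>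
        (\<forall>t\<ge>0. X_norm (\<xi> t) (\<xi>z t) (v t) (\<eta> t)
                  \<le> \<rho> * exp (- a * t) * X_norm (\<xi> 0) (\<xi>z 0) (v 0) (\<eta> 0) + \<sigma> * sup_norm w))"

text \<open>Convergence to a set means that the distance to it, in the norm \<^const>\<open>X_norm\<close>, tends to 0.\<close>

definition ultimate_bound_estimate ::
    "(real \<Rightarrow> real^'w) set \<Rightarrow>
     ((real \<Rightarrow> real^'n) \<times> (real \<Rightarrow> real^'n) \<times> (real^'v) \<times> (real^'e)) set \<Rightarrow> bool" where
  "ultimate_bound_estimate W \<R> \<longleftrightarrow>
     (\<forall>w\<in>W. \<forall>\<xi> \<xi>z v \<eta>.
        is_solution w \<xi> \<xi>z v \<eta> \<and> compatible (w 0) (\<xi> 0) (v 0) (\<eta> 0) \<longrightarrow>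
        (\<forall>\<epsilon>>0. \<forall>\<^sub>F t in at_top. \<exists>(f, fz, p, q)\<in>\<R>.
            X_norm (\<lambda>z. \<xi> t z - f z) (\<lambda>z. \<xi>z t z - fz z) (v t - p) (\<eta> t - q) < \<epsilon>))"

text \<open>With \<open>\<zeta> = (\<xi>z t 1, \<xi> t 1, \<eta>, v, w)\<close>, the boundary condition reads \<open>\<xi> t 0 = \<Phi>a \<zeta>\<close>, and its time
  derivative \<open>\<Lambda> \<xi>z t 0 = \<Phi>b \<zeta>\<close>. The last block of \<open>\<Phi>b\<close> is taken from the source as it stands; the
  differentiation would give \<open>- (Bv + Bu K2 Dv) Bw\<close> there.\<close>

definition \<Phi>a :: "real^('n + 'n + 'e + 'v + 'w)^'n" where
  "\<Phi>a = 0 ||| (H + Bu ** K2) ||| (Bu ** K1) ||| (Bv + Bu ** K2 ** Dv) ||| 0"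

definition \<Phi>b :: "real^('n + 'n + 'e + 'v + 'w)^'n" where
  "\<Phi>b = ((H + Bu ** K2) ** \<Lambda>) ||| (- (Bu ** K1 ** S)) ||| (- (Bu ** K1 ** R)) |||
        (- (Bv ** M + Bu ** K1 ** S ** Dv + Bu ** K2 ** Dv ** M)) ||| (- (Bv ** Bw))"

definition \<Psi>a ::
    "real^'n^'n \<Rightarrow> real^'n^'n \<Rightarrow> real^'e^'e \<Rightarrow> real^'v^'v \<Rightarrow> real \<Rightarrow> real \<Rightarrow>
     real^('n + 'n + 'e + 'v + 'w)^('n + 'n + 'e + 'v + 'w)" where
  "\<Psi>a P1 P2 P3 P4 \<alpha> \<beta> =
     (let \<theta> = \<alpha> + 0.5 * \<beta>;
          \<psi>11 = - (exp (-1) *\<^sub>R (\<Lambda> ** P2));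
          \<psi>22 = - (exp (-1) *\<^sub>R (\<Lambda> ** P1));
          \<psi>32 = P3 ** S;
          \<psi>33 = He (P3 ** R + \<theta> *\<^sub>R P3);
          \<psi>34 = P3 ** S ** Dv;
          \<psi>44 = He (P4 ** M + \<theta> *\<^sub>R P4);
          \<psi>45 = P4 ** Bw;
          \<psi>55 = - (\<beta> *\<^sub>R mat 1)
      in (\<psi>11 ||| 0   ||| 0             ||| 0             ||| 0  ) ---
         (0   ||| \<psi>22 ||| transpose \<psi>32 ||| 0             ||| 0  ) ---
         (0   ||| \<psi>32 ||| \<psi>33           ||| \<psi>34           ||| 0  ) ---
         (0   ||| 0   ||| transpose \<psi>34 ||| \<psi>44           ||| \<psi>45) ---
         (0   ||| 0   ||| 0             ||| transpose \<psi>45 ||| \<psi>55))"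

definition LMI_matrix ::
    "real^'n^'n \<Rightarrow> real^'n^'n \<Rightarrow> real^'e^'e \<Rightarrow> real^'v^'v \<Rightarrow> real \<Rightarrow> real \<Rightarrow>
     real^(('n + 'n + 'e + 'v + 'w) + 'n + 'n)^(('n + 'n + 'e + 'v + 'w) + 'n + 'n)" where
  "LMI_matrix P1 P2 P3 P4 \<alpha> \<beta> =
     (\<Psi>a P1 P2 P3 P4 \<alpha> \<beta> ||| transpose (P1 ** \<Lambda> ** \<Phi>a) ||| transpose (P2 ** \<Phi>b)) ---
     (P1 ** \<Lambda> ** \<Phi>a      ||| - (P1 ** \<Lambda>)             ||| 0                   ) ---
     (P2 ** \<Phi>b          ||| 0                         ||| - (P2 ** \<Lambda>)        )"

end

definition V ::
    "real^'n^'n \<Rightarrow> real^'n^'n \<Rightarrow> real^'e^'e \<Rightarrow> real^'v^'v \<Rightarrow>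
     (real \<Rightarrow> real^'n) \<Rightarrow> (real \<Rightarrow> real^'n) \<Rightarrow> real^'v \<Rightarrow> real^'e \<Rightarrow> real" where
  "V P1 P2 P3 P4 \<xi> \<xi>z v \<eta> =
     (LINT z:{0..1}|lebesgue. exp (- z) * (\<xi> z \<bullet> (P1 *v \<xi> z))) +
     (LINT z:{0..1}|lebesgue. exp (- z) * (\<xi>z z \<bullet> (P2 *v \<xi>z z))) +
     \<eta> \<bullet> (P3 *v \<eta>) + v \<bullet> (P4 *v v)"

definition ultimate_set ::
    "real^'n^'n \<Rightarrow> real^'n^'n \<Rightarrow> real^'e^'e \<Rightarrow> real^'v^'v \<Rightarrow>
     ((real \<Rightarrow> real^'n) \<times> (real \<Rightarrow> real^'n) \<times> (real^'v) \<times> (real^'e)) set" where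
  "ultimate_set P1 P2 P3 P4 =
     {(\<xi>, \<xi>z, v, \<eta>). H1_deriv \<xi> \<xi>z \<and> V P1 P2 P3 P4 \<xi> \<xi>z v \<eta> \<le> 1}"

end

theory Submission
  imports Defs
begin

text \<open>Along characteristics the solution is transported, so over a time step \<open>h\<close> with \<open>l i * h \<le> 1\<close>
  the weighted energies of \<open>\<xi>\<close> and \<open>\<xi>z\<close> change exactly by the weighted squares of the boundary
  traces; this replaces differentiating \<open>V\<close>, for which solutions are not regular enough. Together
  with the product rule for the ODE states, \<open>V\<close> decays at rate \<open>c = 2 \<alpha> + \<beta>\<close> up to the integral of a
  quadratic form in the traces and in \<open>w\<close>. The LMI makes this form negative definite on \<open>w = 0\<close>, so by
  compactness it is bounded by \<open>C |w|\<^sup>2\<close>. Gronwall's inequality gives ISS, and since \<open>w\<close> is square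
  integrable, \<open>V\<close> tends to \<open>0\<close>; hence the last block of \<open>\<Phi>b\<close>, which multiplies \<open>w\<close>, plays no role.\<close>

section \<open>Quadratic forms and integrals on intervals\<close>

text \<open>The equations are available only in weak form: transport as an L2 limit of difference
  quotients, the equation for \<open>v\<close> integrated in time. So identities are first obtained
  for primitives. The spatial primitive of \<xi> turns the L2 limit into a pointwise one, and
  equality of primitives gives the identities for \<open>\<xi>z\<close> almost everywhere.

  The numbers in the hypotheses come from the energy balance. The weight exp(-z) is 1 at the inflow
  end and exp(-1) at the outflow end, which is the factor in the first two diagonal blocks of the
  LMI. A shift by \<open>l i * h\<close> shrinks the weight by exp(- l i * h), so growth at rate
  \<open>c\<close> is absorbed as long as \<open>c \<le> l i\<close>; the bound on 2 \<alpha> +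
  \<beta> guarantees this. The components travel at different speeds, so a time step is limited by
  the fastest one, and the global estimate is assembled from windows of that length.\<close>

text \<open>By homogeneity it suffices to bound \<open>q / r\<close> on the unit sphere, and only
  where \<open>q\<close> is nonnegative. That part is compact, and \<open>r\<close> has no zero on
  it, since a zero of \<open>r\<close> would force \<open>q\<close> to be negative. This is in the
  spirit of Finsler's lemma.\<close>

lemma quadratic_form_le:
  fixes q r :: "'a::euclidean_space \<Rightarrow> real"
  assumes cont: "continuous_on UNIV q" "continuous_on UNIV r"
    and hom: "\<And>x z. q (x *\<^sub>R z) = x\<^sup>2 * q z" "\<And>x z. r (x *\<^sub>R z) = x\<^sup>2 * r z"
    and r_nonneg: "\<And>z. 0 \<le> r z"
    and neg: "\<And>z. z \<noteq> 0 \<Longrightarrow> r z = 0 \<Longrightarrow> q z < 0"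
  shows "\<exists>C>0. \<forall>z. q z \<le> C * r z"
proof -
  define T where "T = sphere (0 :: 'a) 1 \<inter> {z. 0 \<le> q z}"
  have "closed {z. 0 \<le> q z}"
    using closed_Collect_le[of "\<lambda>_. 0" q] cont by simp
  then have "compact T"
    unfolding T_def by (intro compact_Int_closed) auto
  have r0: "r z \<noteq> 0" if "z \<in> T" for z
    using that neg[of z] by (cases "z = 0") (auto simp: T_def)
  define g where "g z = q z / r z" for z
  have "continuous_on T g"
    unfolding g_def using r0
    by (intro continuous_on_divide continuous_on_subset[OF cont(1)] continuous_on_subset[OF cont(2)]) auto
  then have "compact (g ` T)" using \<open>compact T\<close> by (rule compact_continuous_image)
  then obtain C where "C > 0" "\<And>y. y \<in> g ` T \<Longrightarrow> norm y \<le> C"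
    using compact_imp_bounded bounded_pos by metis
  then have C: "\<And>z. z \<in> T \<Longrightarrow> g z \<le> C" "C > 0" by force+
  have "q x \<le> C * r x" for x
  proof (cases "q x \<le> 0")
    case True
    then show ?thesis using C(2) r_nonneg[of x] by (smt (verit) mult_nonneg_nonneg)
  next
    case False
    then have "x \<noteq> 0" using hom(1)[of 0 x] by auto
    define z where "z = (1 / norm x) *\<^sub>R x"
    have qz: "q z = q x / (norm x)\<^sup>2" and rz: "r z = r x / (norm x)\<^sup>2"
      unfolding z_def hom by (simp_all add: power_divide)
    have "z \<in> T"
      using False \<open>x \<noteq> 0\<close> qz by (simp add: T_def z_def)
    then have "q z \<le> C * r z"
      using C(1)[of z] r0[of z] r_nonneg[of z] by (simp add: g_def divide_le_eq)
    then show ?thesis using \<open>x \<noteq> 0\<close> unfolding qz rz by (simp add: divide_le_cancel)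
  qed
  then show ?thesis using \<open>C > 0\<close> by blast
qed

text \<open>The difference, extended by zero, integrates to zero over every interval, so its
  averages over \<open>[x, x + h]\<close> vanish; by Lebesgue differentiation they converge to its
  value off a negligible set. This carries identities from \<xi> over to its weak
  derivative.\<close>

lemma ae_eq_if_integrals_eq:
  fixes f g :: "real \<Rightarrow> real"
  assumes f: "f integrable_on {a..b}" and g: "g integrable_on {a..b}"
    and eq: "\<And>z. z \<in> {a..b} \<Longrightarrow> integral {a..z} f = integral {a..z} g"
  obtains N where "negligible N" "\<And>x. x \<in> {a..b} - N \<Longrightarrow> f x = g x"
proof -
  define d where "d x = (if x \<in> {a..b} then f x - g x else 0)" for x
  have d_int: "((\<lambda>x. f x - g x) has_integral 0) {u..v}" if "a \<le> u" "v \<le> b" for u v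
  proof (cases "u \<le> v")
    case True
    have *: "integral {u..v} h = integral {a..v} h - integral {a..u} h" "h integrable_on {u..v}"
      if "h integrable_on {a..b}" for h :: "real \<Rightarrow> real"
    proof -
      have h: "h integrable_on {a..v}"
        using that by (rule integrable_on_subinterval) (use \<open>v \<le> b\<close> in auto)
      show "integral {u..v} h = integral {a..v} h - integral {a..u} h"
        using Henstock_Kurzweil_Integration.integral_combine[OF \<open>a \<le> u\<close> True h] by simp
      show "h integrable_on {u..v}"
        using that by (rule integrable_on_subinterval) (use \<open>v \<le> b\<close> \<open>a \<le> u\<close> in auto)
    qed
    have "integral {u..v} (\<lambda>x. f x - g x) = 0"
      using *[OF f] *[OF g] eq[of u] eq[of v] that True
      by (simp add: Henstock_Kurzweil_Integration.integral_diff)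
    moreover have "(\<lambda>x. f x - g x) integrable_on {u..v}"
      using *[OF f] *[OF g] by (intro integrable_diff)
    ultimately show ?thesis by (metis integrable_integral)
  qed auto
  have d0: "(d has_integral 0) (cbox u v)" for u v
  proof -
    have "((\<lambda>x. f x - g x) has_integral 0) ({a..b} \<inter> {u..v})"
      using d_int[of "max a u" "min b v"] by simp
    then show ?thesis unfolding d_def
      using has_integral_restrict_Int[of "{a..b}" "\<lambda>x. f x - g x" 0 "{u..v}"] by simp
  qed
  then have "d integrable_on cbox u v" for u v by blast
  then obtain N where N: "negligible N" "\<And>x e. \<lbrakk>x \<notin> N; 0 < e\<rbrakk> \<Longrightarrow> \<exists>\<delta>>0. \<forall>h. 0 < h \<and> h < \<delta> \<longrightarrow>
      norm (integral (cbox x (x + h *\<^sub>R One)) d /\<^sub>R h ^ DIM(real) - d x) < e"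
    using integrable_ccontinuous_explicit[of d] by metis
  have "f x = g x" if "x \<in> {a..b} - N" for x
  proof -
    have "norm (d x) < e" if "e > 0" for e
    proof -
      obtain \<delta> where \<delta>: "\<delta> > 0" "\<And>h. 0 < h \<and> h < \<delta> \<Longrightarrow>
          norm (integral (cbox x (x + h *\<^sub>R One)) d /\<^sub>R h ^ DIM(real) - d x) < e"
        using N(2)[of x e] \<open>x \<in> {a..b} - N\<close> \<open>e > 0\<close> by blast
      have "integral (cbox x (x + (\<delta>/2) *\<^sub>R One)) d = 0"
        using d0 by blast
      then show ?thesis using \<delta>(2)[of "\<delta>/2"] \<delta>(1) by simp
    qed
    from this[of "norm (d x)"] have "d x = 0" by auto
    then show ?thesis using that by (simp add: d_def)
  qed
  with N(1) that show ?thesis by blast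
qed

text \<open>Substitution along a characteristic: position \<open>c - l * s\<close> is paired with
  time \<open>s\<close>, which turns space integrals near a boundary into time integrals.\<close>

lemma has_integral_reflect_affine:
  fixes f :: "real \<Rightarrow> 'b::real_normed_vector"
  assumes f: "(f has_integral I) {a..b}" and "l > 0" "a \<le> b"
  shows "((\<lambda>s. f (c - l * s)) has_integral I /\<^sub>R l) {(c - b) / l..(c - a) / l}"
proof -
  have "((\<lambda>s. f (- s)) has_integral I) {-b..-a}" using f by simp
  from has_integral_affinity'[OF this[folded box_real] \<open>l > 0\<close>, of "-c"]
  have "((\<lambda>x. f (- (l * x - c))) has_integral I /\<^sub>R l) {(- b - - c) /\<^sub>R l..(- a - - c) /\<^sub>R l}"
    by simp
  moreover have "- (l * x - c) = c - l * x" for x by simp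
  moreover have "(- b - - c) /\<^sub>R l = (c - b) / l" "(- a - - c) /\<^sub>R l = (c - a) / l"
    by (simp_all add: divide_inverse_commute)
  ultimately show ?thesis by simp
qed

section \<open>A product rule for Lipschitz functions\<close>

text \<open>Quadratically small increments force a zero derivative at every point. Thus an identity
  between functions follows from local estimates alone, without differentiating either side.\<close>

lemma constant_if_quadratic_increments:
  fixes d :: "real \<Rightarrow> 'a::real_normed_vector"
  assumes le: "a \<le> b"
    and d: "\<And>s t. a \<le> s \<Longrightarrow> s \<le> t \<Longrightarrow> t \<le> b \<Longrightarrow> norm (d t - d s) \<le> C * (t - s)\<^sup>2"
  shows "d b = d a"
proof -
  have "(d has_derivative (\<lambda>h. 0)) (at x within {a..b})" if x: "x \<in> {a..b}" for x
  proof (rule has_derivativeI)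
    have le': "norm (norm ((d y - d x) - 0) / norm (y - x)) \<le> C * norm (y - x)" if "y \<in> {a..b}" for y
    proof -
      have "norm (d y - d x) \<le> C * (norm (y - x))\<^sup>2"
        using d[of x y] d[of y x] x that by (cases "x \<le> y") (auto simp: norm_minus_commute power2_commute)
      then show ?thesis by (cases "x = y") (auto simp: divide_le_eq power2_eq_square mult.assoc)
    qed
    have lim: "((\<lambda>y. C * norm (y - x)) \<longlongrightarrow> 0) (at x within {a..b})"
      by (auto intro!: tendsto_eq_intros)
    have ev: "\<forall>\<^sub>F y in at x within {a..b}. norm ((d y - d x - 0) /\<^sub>R norm (y - x)) \<le> C * norm (y - x)"
      using le' by (auto simp: eventually_at_filter divide_inverse_commute)
    show "((\<lambda>y. (d y - d x - 0) /\<^sub>R norm (y - x)) \<longlongrightarrow> 0) (at x within {a..b})"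
      by (rule Lim_null_comparison[OF ev lim])
  qed auto
  from has_derivative_zero_constant[OF _ this] le show ?thesis by fastforce
qed

lemma has_integral_tail:
  fixes f :: "real \<Rightarrow> 'a::banach"
  assumes I: "(f has_integral I) {a..c}" and J: "(f has_integral J) {a..b}" and "a \<le> b" "b \<le> c"
  shows "(f has_integral (I - J)) {b..c}"
proof -
  have "f integrable_on {b..c}"
    by (rule integrable_on_subinterval[of f "{a..c}"]) (use I \<open>a \<le> b\<close> in auto)
  moreover have "integral {a..b} f + integral {b..c} f = integral {a..c} f"
    using assms by (intro Henstock_Kurzweil_Integration.integral_combine) auto
  then have "integral {b..c} f = I - J"
    using integral_unique[OF I] integral_unique[OF J] by (simp add: algebra_simps)
  ultimately show ?thesis by (metis integrable_integral)
qed

lemma continuous_on_primitive: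
  fixes f f' :: "real \<Rightarrow> 'a::euclidean_space"
  assumes "\<And>s. s \<in> {a..b} \<Longrightarrow> (f' has_integral (f s - f a)) {a..s}"
  shows "continuous_on {a..b} f"
proof (cases "a \<le> b")
  case True
  then have "f' integrable_on {a..b}" using assms[of b] by auto
  then have "continuous_on {a..b} (\<lambda>s. f a + integral {a..s} f')"
    by (intro continuous_intros indefinite_integral_continuous_1)
  then show ?thesis
    by (rule continuous_on_eq) (use assms[THEN integral_unique] in auto)
qed auto

text \<open>The product rule when derivatives exist only as bounded integrands, as for
  \<open>v\<close> driven by a measurable \<open>w\<close>. Bounded integrands make \<open>u\<close>
  and \<open>v\<close> Lipschitz, so the product minus the primitive of the expected integrand
  changes by O((t - s)^2) on \<open>[s, t]\<close> and is constant.\<close>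

lemma has_integral_bilinear_Lipschitz:
  fixes prod :: "'a::euclidean_space \<Rightarrow> 'b::euclidean_space \<Rightarrow> 'c::euclidean_space"
    and u u' :: "real \<Rightarrow> 'a" and v v' :: "real \<Rightarrow> 'b"
  assumes bil: "bounded_bilinear prod" and le: "a \<le> b"
    and u: "\<And>t. t \<in> {a..b} \<Longrightarrow> (u' has_integral (u t - u a)) {a..t}"
    and v: "\<And>t. t \<in> {a..b} \<Longrightarrow> (v' has_integral (v t - v a)) {a..t}"
    and bu: "bounded (u' ` {a..b})" and bv: "bounded (v' ` {a..b})"
  shows "((\<lambda>s. prod (u' s) (v s) + prod (u s) (v' s)) has_integral
           (prod (u b) (v b) - prod (u a) (v a))) {a..b}"
proof -
  interpret bounded_bilinear prod by fact
  have step: "(f' has_integral (f t - f s)) {s..t}"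
    if f: "\<And>t. t \<in> {a..b} \<Longrightarrow> (f' has_integral (f t - f a)) {a..t}" and st: "a \<le> s" "s \<le> t" "t \<le> b"
    for f f' :: "real \<Rightarrow> 'd::euclidean_space" and s t
    using has_integral_tail[OF f[of t] f[of s]] st by simp
  obtain Ku where Ku: "Ku > 0" "\<And>s. s \<in> {a..b} \<Longrightarrow> norm (u' s) \<le> Ku"
    using bu unfolding bounded_pos by auto
  obtain Kv where Kv: "Kv > 0" "\<And>s. s \<in> {a..b} \<Longrightarrow> norm (v' s) \<le> Kv"
    using bv unfolding bounded_pos by auto
  have lip: "norm (f t - f s) \<le> K * (t - s)"
    if "\<And>t. t \<in> {a..b} \<Longrightarrow> (f' has_integral (f t - f a)) {a..t}" "a \<le> s" "s \<le> t" "t \<le> b"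
       "\<And>s. s \<in> {a..b} \<Longrightarrow> norm (f' s) \<le> K" "K > 0"
    for f f' :: "real \<Rightarrow> 'd::euclidean_space" and s t K
    using has_integral_bound[of K f' "f t - f s" s t] step[of f' f s t] that by auto
  have absint: "f' absolutely_integrable_on {a..b}"
    if f: "\<And>t. t \<in> {a..b} \<Longrightarrow> (f' has_integral (f t - f a)) {a..t}"
      and K: "\<And>s. s \<in> {a..b} \<Longrightarrow> norm (f' s) \<le> K"
    for f f' :: "real \<Rightarrow> 'd::euclidean_space" and K
  proof (rule absolutely_integrable_integrable_bound[OF K])
    show "f' integrable_on {a..b}" using f[of b] le by auto
  qed auto
  have bl: "bilinear prod"
    using bil by (simp add: bilinear_conv_bounded_bilinear)
  have meas: "f \<in> borel_measurable (lebesgue_on {a..b})" "bounded (f ` {a..b})"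
    if "continuous_on {a..b} f" for f :: "real \<Rightarrow> 'd::euclidean_space"
    using that by (auto intro!: continuous_imp_measurable_on_sets_lebesgue compact_imp_bounded
        compact_continuous_image)
  define g where "g s = prod (u' s) (v s) + prod (u s) (v' s)" for s
  have g1: "(\<lambda>s. prod (u s) (v' s)) absolutely_integrable_on {a..b}"
    by (rule absolutely_integrable_bounded_measurable_product[OF bl meas(1) _ meas(2)])
      (use continuous_on_primitive[OF u] absint[OF v Kv(2)] in auto)
  have bl': "bilinear (\<lambda>x y. prod y x)"
    using flip by (simp add: bilinear_conv_bounded_bilinear)
  have g2: "(\<lambda>s. prod (u' s) (v s)) absolutely_integrable_on {a..b}"
    by (rule absolutely_integrable_bounded_measurable_product[OF bl' meas(1) _ meas(2)])
      (use continuous_on_primitive[OF v] absint[OF u Ku(2)] in auto)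
  have g: "g integrable_on {a..b}"
    unfolding g_def using g1 g2 by (intro integrable_add) (auto simp: absolutely_integrable_on_def)
  obtain B where B: "B > 0" "\<And>x y. norm (prod x y) \<le> norm x * norm y * B"
    using pos_bounded by blast
  define d where "d t = prod (u t) (v t) - integral {a..t} g" for t
  have "d b = d a"
  proof (rule constant_if_quadratic_increments[OF le])
    fix s t assume st: "a \<le> s" "s \<le> t" "t \<le> b"
    have gst: "(g has_integral integral {s..t} g) {s..t}"
      using integrable_on_subinterval[OF g, of s t] st by (auto intro: integrable_integral)
    have "integral {a..s} g + integral {s..t} g = integral {a..t} g"
      using st integrable_on_subinterval[OF g, of a t]
      by (intro Henstock_Kurzweil_Integration.integral_combine) auto
    from this[symmetric] have dst: "d t - d s = prod (u t) (v t) - prod (u s) (v s) - integral {s..t} g"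
      by (simp add: d_def)
    \<comment> \<open>Freezing \<open>v\<close> at \<open>t\<close> and \<open>u\<close> at
      \<open>s\<close> reproduces the increment of the product exactly, as
      \<open>prod (u t - u s) (v t) + prod (u s) (v t - v s)\<close>.\<close>
    have 1: "((\<lambda>\<sigma>. prod (u' \<sigma>) (v t)) has_integral prod (u t - u s) (v t)) {s..t}"
      using has_integral_linear[OF step[OF u st] bounded_linear_left] by (simp add: o_def)
    have 2: "((\<lambda>\<sigma>. prod (u s) (v' \<sigma>)) has_integral prod (u s) (v t - v s)) {s..t}"
      using has_integral_linear[OF step[OF v st] bounded_linear_right] by (simp add: o_def)
    have "((\<lambda>\<sigma>. prod (u' \<sigma>) (v t) + prod (u s) (v' \<sigma>) - g \<sigma>) has_integral (d t - d s)) {s..t}"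
      using has_integral_diff[OF has_integral_add[OF 1 2] gst] by (simp add: dst diff_left diff_right)
    \<comment> \<open>Unfreezing costs a Lipschitz increment times a bounded derivative: the
      pointwise error is linear in \<open>t - s\<close>, hence quadratic after integration.\<close>
    moreover have "norm (prod (u' \<sigma>) (v t) + prod (u s) (v' \<sigma>) - g \<sigma>) \<le> 2 * (Ku * Kv * B) * (t - s)"
      if \<sigma>: "\<sigma> \<in> {s..t}" for \<sigma>
    proof -
      have "prod (u' \<sigma>) (v t) + prod (u s) (v' \<sigma>) - g \<sigma>
          = prod (u' \<sigma>) (v t - v \<sigma>) - prod (u \<sigma> - u s) (v' \<sigma>)"
        by (simp add: g_def diff_left diff_right)
      also have "norm \<dots> \<le> norm (prod (u' \<sigma>) (v t - v \<sigma>)) + norm (prod (u \<sigma> - u s) (v' \<sigma>))"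
        by (rule norm_triangle_ineq4)
      also have "\<dots> \<le> Ku * (Kv * (t - s)) * B + (Ku * (t - s)) * Kv * B"
      proof (intro add_mono order_trans[OF B(2)] mult_right_mono mult_mono)
        show "norm (v t - v \<sigma>) \<le> Kv * (t - s)"
          using lip[OF v, of \<sigma> t Kv] Kv st \<sigma> by (smt (verit) atLeastAtMost_iff mult_left_mono)
        show "norm (u \<sigma> - u s) \<le> Ku * (t - s)"
          using lip[OF u, of s \<sigma> Ku] Ku st \<sigma> by (smt (verit) atLeastAtMost_iff mult_left_mono)
      qed (use Ku Kv B st \<sigma> in auto)
      finally show ?thesis by (simp add: algebra_simps)
    qed
    ultimately have "norm (d t - d s) \<le> (2 * (Ku * Kv * B) * (t - s)) * measure lborel {s..t}"
      using has_integral_bound[where B = "2 * (Ku * Kv * B) * (t - s)" and a = s and b = t] Ku Kv B st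
      by auto
    then show "norm (d t - d s) \<le> (2 * (Ku * Kv * B)) * (t - s)\<^sup>2"
      using st by (simp add: power2_eq_square mult.assoc)
  qed
  then have "integral {a..b} g = prod (u b) (v b) - prod (u a) (v a)"
    by (simp add: d_def algebra_simps)
  then show ?thesis using g unfolding g_def[abs_def] by (metis integrable_integral)
qed

section \<open>Weighted energy of a transported profile\<close>

lemma absolutely_integrable_continuous_mult:
  fixes f g :: "real \<Rightarrow> real"
  assumes "continuous_on {a..b} f" "g absolutely_integrable_on {a..b}"
  shows "(\<lambda>x. f x * g x) absolutely_integrable_on {a..b}"
  using assms
  by (intro absolutely_integrable_bounded_measurable_product_real)
    (auto intro!: continuous_imp_measurable_on_sets_lebesgue compact_imp_bounded compact_continuous_image)

text \<open>After time \<open>h\<close> the profile \<open>q1\<close> consists of \<open>q0\<close>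
  shifted by \<open>l * h\<close> and, on \<open>[0, l * h]\<close>, of boundary data that entered
  at time \<open>h - z / l\<close>; the part of \<open>q0\<close> beyond \<open>1 - l * h\<close>
  has left. The factor \<open>l\<close> comes from dz = l ds. The estimates \<open>le1\<close>,
  \<open>le2\<close>, \<open>le3\<close> treat the entering, leaving and surviving parts; each
  compares growth at rate \<open>c\<close> with a weight that changes at rate \<open>l\<close> along
  a characteristic.\<close>

lemma transport_energy_step:
  fixes q0 q1 k :: "real \<Rightarrow> real"
  assumes l: "0 < l" and h: "0 \<le> h" "l * h \<le> 1" and c: "0 \<le> c" "c \<le> l"
    and q0: "(\<lambda>z. exp (- z) * (q0 z)\<^sup>2) integrable_on {0..1}"
    and q1: "(\<lambda>z. exp (- z) * (q1 z)\<^sup>2) integrable_on {0..1}"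
    and out: "negligible N" "\<And>z. z \<in> {0..1 - l * h} - N \<Longrightarrow> q1 (z + l * h) = q0 z"
    and inflow: "negligible N'" "\<And>z. z \<in> {0..l * h} - N' \<Longrightarrow> q1 z = k (h - z / l)"
  shows "(\<lambda>s. exp (c * s) * (k s)\<^sup>2) integrable_on {0..h}"
    and "(\<lambda>s. exp (c * s) * (q0 (1 - l * s))\<^sup>2) integrable_on {0..h}"
    and "exp (c * h) * integral {0..1} (\<lambda>z. exp (- z) * (q1 z)\<^sup>2) \<le>
      integral {0..1} (\<lambda>z. exp (- z) * (q0 z)\<^sup>2)
      + l * integral {0..h} (\<lambda>s. exp (c * s) * (k s)\<^sup>2)
      - l * exp (-1) * integral {0..h} (\<lambda>s. exp (c * s) * (q0 (1 - l * s))\<^sup>2)"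
proof -
  define e0 e1 where "e0 z = exp (- z) * (q0 z)\<^sup>2" and "e1 z = exp (- z) * (q1 z)\<^sup>2" for z
  have e0: "e0 integrable_on {0..1}" and e1: "e1 integrable_on {0..1}"
    using q0 q1 by (simp_all add: e0_def[abs_def] e1_def[abs_def])
  have lh: "0 \<le> l * h" using l h by simp
  define I1 I2 J1 J2 where "I1 = integral {0..l * h} e1" and "I2 = integral {l * h..1} e1"
    and "J1 = integral {0..1 - l * h} e0" and "J2 = integral {1 - l * h..1} e0"
  have I: "integral {0..1} e1 = I1 + I2" and J: "integral {0..1} e0 = J1 + J2"
    unfolding I1_def I2_def J1_def J2_def using lh h e0 e1
    by (auto intro!: Henstock_Kurzweil_Integration.integral_combine[symmetric])
  have I1: "(e1 has_integral I1) {0..l * h}" and I2: "(e1 has_integral I2) {l * h..1}"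
    and J1: "(e0 has_integral J1) {0..1 - l * h}" and J2: "(e0 has_integral J2) {1 - l * h..1}"
    unfolding I1_def I2_def J1_def J2_def using lh h e0 e1
    by (auto intro!: integrable_integral intro: integrable_on_subinterval)
  \<comment> \<open>The substitutions deliver the boundary integrals with weight
    \<open>exp (r + l * s)\<close>. Nonnegative integrands are absolutely integrable, so a
    continuous factor may change the weight to \<open>exp (c * s)\<close>.\<close>
  have weight: "(\<lambda>s. exp (c * s) * f s) integrable_on {0..h}"
    if f: "((\<lambda>s. exp (r + l * s) * f s) has_integral I) {0..h}" and nn: "\<And>s. 0 \<le> f s" for r f I
  proof -
    have "(\<lambda>s. exp (r + l * s) * f s) absolutely_integrable_on {0..h}"
      using f nn by (intro nonnegative_absolutely_integrable_1) auto
    then have "(\<lambda>s. exp (c * s - (r + l * s)) * (exp (r + l * s) * f s)) absolutely_integrable_on {0..h}"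
      by (rule absolutely_integrable_continuous_mult[rotated]) (intro continuous_intros)
    moreover have "(\<lambda>s. exp (c * s - (r + l * s)) * (exp (r + l * s) * f s)) = (\<lambda>s. exp (c * s) * f s)"
      by (simp add: exp_diff)
    ultimately show ?thesis
      by (simp add: absolutely_integrable_on_def)
  qed
  have "((\<lambda>z. exp (- z) * (k (h - z / l))\<^sup>2) has_integral I1) {0..l * h}"
    using I1 by (rule has_integral_spike[OF inflow(1), rotated]) (use inflow(2) in \<open>auto simp: e1_def\<close>)
  from has_integral_reflect_affine[OF this l lh, of "l * h"]
  moreover have "h - (l * h - l * s) / l = s" "(l * h - 0) / l = h" for s
    using l by (auto simp: field_simps)
  moreover have "I1 /\<^sub>R l = I1 / l" by (simp add: divide_inverse_commute)
  ultimately have k1: "((\<lambda>s. exp (- l * h + l * s) * (k s)\<^sup>2) has_integral I1 / l) {0..h}"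
    by simp
  from weight[OF this] show A: "(\<lambda>s. exp (c * s) * (k s)\<^sup>2) integrable_on {0..h}" by simp
  \<comment> \<open>What enters at time \<open>s\<close> sits at \<open>l * (h - s)\<close> at time
    \<open>h\<close>, with weight \<open>exp (- l * (h - s))\<close>; multiplication by
    \<open>exp (c * h)\<close> raises this to at most \<open>exp (c * s)\<close>.\<close>
  have le1: "exp (c * h) * I1 \<le> l * integral {0..h} (\<lambda>s. exp (c * s) * (k s)\<^sup>2)"
  proof -
    have "exp (c * h) * (I1 / l) \<le> integral {0..h} (\<lambda>s. exp (c * s) * (k s)\<^sup>2)"
    proof (rule has_integral_le[OF has_integral_mult_right[OF k1] integrable_integral[OF A]])
      fix s assume s: "s \<in> {0..h}"
      have "(c - l) * (h - s) \<le> 0" using c s by (auto intro: mult_nonpos_nonneg)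
      then have "exp (c * h + (- l * h + l * s)) \<le> exp (c * s)" by (simp add: algebra_simps)
      then show "exp (c * h) * (exp (- l * h + l * s) * (k s)\<^sup>2) \<le> exp (c * s) * (k s)\<^sup>2"
        by (simp add: exp_add mult_right_mono flip: mult.assoc)
    qed
    then show ?thesis using l by (simp add: field_simps)
  qed
  have "((\<lambda>s. e0 (1 - l * s)) has_integral J2 / l) {0..h}"
    using has_integral_reflect_affine[OF J2 l, of 1] h l by (simp add: divide_inverse_commute[of J2])
  then have k2: "((\<lambda>s. exp (- 1 + l * s) * (q0 (1 - l * s))\<^sup>2) has_integral J2 / l) {0..h}"
    by (simp add: e0_def)
  from weight[OF this] show B: "(\<lambda>s. exp (c * s) * (q0 (1 - l * s))\<^sup>2) integrable_on {0..h}" by simp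
  \<comment> \<open>What leaves at time \<open>s\<close> started at \<open>1 - l * s\<close>, with
    weight \<open>exp (- 1 + l * s)\<close>; the factor \<open>exp (-1)\<close> is the weight at the
    outflow end.\<close>
  have le2: "l * exp (-1) * integral {0..h} (\<lambda>s. exp (c * s) * (q0 (1 - l * s))\<^sup>2) \<le> J2"
  proof -
    have "exp (-1) * integral {0..h} (\<lambda>s. exp (c * s) * (q0 (1 - l * s))\<^sup>2) \<le> J2 / l"
    proof (rule has_integral_le[OF has_integral_mult_right[OF integrable_integral[OF B]] k2])
      fix s assume s: "s \<in> {0..h}"
      have "c * s \<le> l * s" using c s by (auto intro: mult_right_mono)
      then have "exp (- 1) * exp (c * s) \<le> exp (- 1 + l * s)" by (simp add: exp_add[symmetric])
      then show "exp (- 1) * (exp (c * s) * (q0 (1 - l * s))\<^sup>2) \<le> exp (- 1 + l * s) * (q0 (1 - l * s))\<^sup>2"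
        by (simp add: mult_right_mono flip: mult.assoc)
    qed
    then show ?thesis using l by (simp add: field_simps)
  qed
  \<comment> \<open>The surviving part picks up the factor \<open>exp (- (l * h))\<close>, which
    offsets \<open>exp (c * h)\<close>.\<close>
  have "((\<lambda>z. e1 (z + l * h)) has_integral I2) {0..1 - l * h}"
    using has_integral_affinity'[OF I2[folded box_real], of 1 "l * h"] by simp
  then have "((\<lambda>z. exp (- (l * h)) * e0 z) has_integral I2) {0..1 - l * h}"
    by (rule has_integral_spike[OF out(1), rotated])
      (use out(2) in \<open>auto simp: e1_def e0_def exp_add[symmetric] exp_minus field_simps simp flip: exp_minus\<close>)
  moreover have "((\<lambda>z. exp (- (l * h)) * e0 z) has_integral exp (- (l * h)) * J1) {0..1 - l * h}"
    using J1 by (rule has_integral_mult_right)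
  ultimately have I2': "I2 = exp (- (l * h)) * J1" by (rule has_integral_unique)
  have "J1 \<ge> 0" using J1 by (rule has_integral_nonneg) (auto simp: e0_def)
  moreover have "c * h \<le> l * h" using c h by (auto intro: mult_right_mono)
  ultimately have "exp (c * h + - (l * h)) * J1 \<le> 1 * J1" by (intro mult_right_mono) auto
  then have le3: "exp (c * h) * I2 \<le> J1" unfolding I2' exp_add by simp
  show "exp (c * h) * integral {0..1} (\<lambda>z. exp (- z) * (q1 z)\<^sup>2) \<le>
      integral {0..1} (\<lambda>z. exp (- z) * (q0 z)\<^sup>2)
      + l * integral {0..h} (\<lambda>s. exp (c * s) * (k s)\<^sup>2)
      - l * exp (-1) * integral {0..h} (\<lambda>s. exp (c * s) * (q0 (1 - l * s))\<^sup>2)"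
    using le1 le2 le3 I J unfolding e0_def[abs_def] e1_def[abs_def] by (simp add: algebra_simps)
qed

section \<open>Transport along characteristics\<close>

lemma absolutely_integrable_sq_integrable:
  fixes f :: "real \<Rightarrow> 'a::euclidean_space"
  assumes "square_integrable {a..b} f"
  shows "f absolutely_integrable_on {a..b}"
proof (rule measurable_bounded_by_integrable_imp_absolutely_integrable)
  show "f \<in> borel_measurable (lebesgue_on {a..b})"
    using assms by (simp add: square_integrable_def set_borel_measurable_def borel_measurable_restrict_space_iff)
  show "(\<lambda>x. 1 + f x \<bullet> f x) integrable_on {a..b}"
    using assms by (intro integrable_add) (auto simp: square_integrable_def absolutely_integrable_on_def)
  show "norm (f x) \<le> 1 + f x \<bullet> f x" for x
  proof -
    have "2 * norm (f x) \<le> 1 + (norm (f x))\<^sup>2"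
      using sum_squares_bound[of 1 "norm (f x)"] by simp
    then have "norm (f x) \<le> 1 + (norm (f x))\<^sup>2"
      using norm_ge_zero[of "f x"] by linarith
    then show ?thesis by (simp add: power2_norm_eq_inner)
  qed
qed auto

lemma square_integrable_linear:
  fixes h :: "'a::euclidean_space \<Rightarrow> 'b::euclidean_space"
  assumes h: "bounded_linear h" and f: "square_integrable A f" and A: "A \<in> sets lebesgue"
  shows "square_integrable A (\<lambda>x. h (f x))"
proof -
  obtain K where K: "\<And>x. norm (h x) \<le> norm x * K" using h bounded_linear.bounded by blast
  have meas: "f \<in> borel_measurable (lebesgue_on A)"
    using f A by (simp add: square_integrable_def set_borel_measurable_def borel_measurable_restrict_space_iff)
  have hm: "h \<in> borel_measurable borel"
    using h by (intro borel_measurable_continuous_onI linear_continuous_on)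
  have m: "(\<lambda>x. h (f x)) \<in> borel_measurable (lebesgue_on A)"
    by (rule measurable_compose[OF meas hm])
  have "(\<lambda>x. h (f x) \<bullet> h (f x)) absolutely_integrable_on A"
  proof (rule measurable_bounded_by_integrable_imp_absolutely_integrable)
    show "(\<lambda>x. h (f x) \<bullet> h (f x)) \<in> borel_measurable (lebesgue_on A)"
      using m by (intro borel_measurable_inner)
    show "(\<lambda>x. K\<^sup>2 * (f x \<bullet> f x)) integrable_on A"
      using f by (intro integrable_on_mult_right) (auto simp: square_integrable_def absolutely_integrable_on_def)
    show "norm (h (f x) \<bullet> h (f x)) \<le> K\<^sup>2 * (f x \<bullet> f x)" for x
      using power_mono[OF K[of "f x"], of 2] norm_ge_zero[of "h (f x)"]
      by (simp add: power2_norm_eq_inner power_mult_distrib mult.commute)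
  qed fact
  with m A show ?thesis
    by (simp add: square_integrable_def set_borel_measurable_def borel_measurable_restrict_space_iff)
qed

lemma square_integrable_add:
  fixes f g :: "real \<Rightarrow> 'a::euclidean_space"
  assumes f: "square_integrable A f" and g: "square_integrable A g" and A: "A \<in> sets lebesgue"
  shows "square_integrable A (\<lambda>x. f x + g x)"
proof -
  have m: "(\<lambda>x. f x + g x) \<in> borel_measurable (lebesgue_on A)"
    using f g A by (intro borel_measurable_add)
      (simp_all add: square_integrable_def set_borel_measurable_def borel_measurable_restrict_space_iff)
  have "(\<lambda>x. (f x + g x) \<bullet> (f x + g x)) absolutely_integrable_on A"
  proof (rule measurable_bounded_by_integrable_imp_absolutely_integrable)
    show "(\<lambda>x. (f x + g x) \<bullet> (f x + g x)) \<in> borel_measurable (lebesgue_on A)"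
      using m by (intro borel_measurable_inner)
    show "(\<lambda>x. 2 * (f x \<bullet> f x) + 2 * (g x \<bullet> g x)) integrable_on A"
      using f g by (intro integrable_add) (auto simp: square_integrable_def absolutely_integrable_on_def)
    show "norm ((f x + g x) \<bullet> (f x + g x)) \<le> 2 * (f x \<bullet> f x) + 2 * (g x \<bullet> g x)" for x
      using inner_ge_zero[of "f x - g x"] inner_ge_zero[of "f x + g x"]
      by (simp add: inner_add inner_diff inner_commute)
  qed fact
  with m A show ?thesis
    by (simp add: square_integrable_def set_borel_measurable_def borel_measurable_restrict_space_iff)
qed

lemma square_integrable_scaleR:
  fixes f :: "real \<Rightarrow> 'a::euclidean_space"
  shows "square_integrable A f \<Longrightarrow> A \<in> sets lebesgue \<Longrightarrow> square_integrable A (\<lambda>x. r *\<^sub>R f x)"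
  by (rule square_integrable_linear[OF bounded_linear_scaleR_right])

lemma square_integrable_diff:
  fixes f g :: "real \<Rightarrow> 'a::euclidean_space"
  assumes "square_integrable A f" "square_integrable A g" "A \<in> sets lebesgue"
  shows "square_integrable A (\<lambda>x. f x - g x)"
  using square_integrable_add[OF assms(1) square_integrable_scaleR[OF assms(2,3), of "-1"] assms(3)]
  by simp

lemma L2_norm_eq_integral:
  assumes "square_integrable {0..1} f"
  shows "L2_norm f = sqrt (integral {0..1} (\<lambda>z. f z \<bullet> f z))"
  using assms by (simp add: L2_norm_def square_integrable_def set_lebesgue_integral_eq_integral)

lemma L2_norm_nonneg: "0 \<le> L2_norm f"
  unfolding L2_norm_def set_lebesgue_integral_def
  by (intro real_sqrt_ge_zero Bochner_Integration.integral_nonneg) auto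

lemma L2_norm_linear_le:
  fixes h :: "'a::euclidean_space \<Rightarrow> 'b::euclidean_space"
  assumes f: "square_integrable {0..1} f" and h: "bounded_linear h" and le: "\<And>x. norm (h x) \<le> norm x"
  shows "L2_norm (\<lambda>z. h (f z)) \<le> L2_norm f"
proof -
  have hf: "square_integrable {0..1} (\<lambda>z. h (f z))"
    by (rule square_integrable_linear[OF h f]) auto
  have "h (f z) \<bullet> h (f z) \<le> f z \<bullet> f z" for z
    using power_mono[OF le[of "f z"], of 2] by (simp add: power2_norm_eq_inner)
  then show ?thesis
    using f hf unfolding L2_norm_eq_integral[OF f] L2_norm_eq_integral[OF hf]
    by (intro real_sqrt_le_mono integral_le) (auto simp: square_integrable_def absolutely_integrable_on_def)
qed

text \<open>Cauchy-Schwarz against the constant 1, read off from the variance: with \<open>m\<close>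
  the mean of |f|, the integral of (|f| - m)^2 equals that of f^2 minus m^2. Consequently L2
  convergence controls primitives uniformly in \<open>z\<close>.\<close>

lemma abs_integral_le_L2_norm:
  fixes f :: "real \<Rightarrow> real"
  assumes f: "square_integrable {0..1} f" and z: "z \<in> {0..1}"
  shows "\<bar>integral {0..z} f\<bar> \<le> L2_norm f"
proof -
  have fa: "f absolutely_integrable_on {0..1}" by (rule absolutely_integrable_sq_integrable[OF f])
  then have fi: "(\<lambda>x. \<bar>f x\<bar>) integrable_on {0..1}" by (simp add: absolutely_integrable_on_def)
  have fi2: "(\<lambda>x. (f x)\<^sup>2) integrable_on {0..1}"
    using f by (simp add: square_integrable_def absolutely_integrable_on_def power2_eq_square)
  define m where "m = integral {0..1} (\<lambda>x. \<bar>f x\<bar>)"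
  have "((\<lambda>x. (f x)\<^sup>2 - 2 * m * \<bar>f x\<bar> + m\<^sup>2) has_integral
      integral {0..1} (\<lambda>x. (f x)\<^sup>2) - 2 * m * m + m\<^sup>2) {0..1}"
    using fi fi2 has_integral_const_real[of "m\<^sup>2" 0 1]
    by (intro has_integral_add has_integral_diff has_integral_mult_right)
      (auto simp: m_def intro: integrable_integral)
  then have "0 \<le> integral {0..1} (\<lambda>x. (f x)\<^sup>2) - 2 * m * m + m\<^sup>2"
  proof (rule has_integral_nonneg)
    show "0 \<le> (f x)\<^sup>2 - 2 * m * \<bar>f x\<bar> + m\<^sup>2" for x
      using zero_le_power2[of "\<bar>f x\<bar> - m"] by (simp add: power2_diff algebra_simps)
  qed
  then have "m\<^sup>2 \<le> integral {0..1} (\<lambda>x. (f x)\<^sup>2)" by (simp add: power2_eq_square)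
  then have "m \<le> L2_norm f"
    unfolding L2_norm_eq_integral[OF f] by (intro real_le_rsqrt) (simp add: power2_eq_square)
  have fz: "f absolutely_integrable_on {0..z}"
    using fa by (rule absolutely_integrable_on_subinterval) (use z in auto)
  have "\<bar>integral {0..z} f\<bar> \<le> integral {0..z} (\<lambda>x. \<bar>f x\<bar>)"
    using fz integral_norm_bound_integral[of f "{0..z}" "\<lambda>x. \<bar>f x\<bar>"] by (simp add: absolutely_integrable_on_def)
  also have "\<dots> \<le> m"
    unfolding m_def using fi fz z by (intro integral_subset_le) (auto simp: absolutely_integrable_on_def)
  finally show ?thesis using \<open>m \<le> L2_norm f\<close> by simp
qed

lemma H1_deriv_continuous: "H1_deriv f g \<Longrightarrow> continuous_on {0..1} f"
  by (rule continuous_on_primitive[of 0 1 g]) (simp add: H1_deriv_def)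

text \<open>The equation holds only in L2, so it is tested on the primitive \<open>F t z\<close> of
  the profile. Along a characteristic the derivative of \<open>F\<close> is
  \<open>l * f (t + r) 0\<close>, whatever the starting point. Hence the integral of the profile
  between two characteristics is conserved, and differentiating it in the starting point gives the
  pointwise statement.\<close>

lemma transport_constant_on_characteristics:
  fixes f q :: "real \<Rightarrow> real \<Rightarrow> real"
  assumes l: "0 < l"
    and reg: "\<And>t. 0 \<le> t \<Longrightarrow> H1_deriv (f t) (q t)"
    and eq: "\<And>t. 0 \<le> t \<Longrightarrow>
      ((\<lambda>s. L2_norm (\<lambda>z. (1 / (s - t)) * (f s z - f t z) + l * q t z)) \<longlongrightarrow> 0) (at t within {0..})"
    and "0 \<le> t" "0 \<le> r" "0 \<le> a" "a + l * r \<le> 1"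
  shows "f (t + r) (a + l * r) = f t a"
proof -
  define F where "F t z = integral {0..z} (f t)" for t z
  have cont: "continuous_on {0..1} (f t)" if "0 \<le> t" for t
    using H1_deriv_continuous[OF reg[OF that]] .
  have derF: "(F t has_real_derivative f t z) (at z within {0..1})" if "0 \<le> t" "z \<in> {0..1}" for t z
    unfolding F_def has_real_derivative_iff_has_vector_derivative
    by (rule integral_has_vector_derivative[OF cont]) (use that in auto)
  \<comment> \<open>The right-hand side does not depend on \<open>z\<close>; this uniformity is what
    later permits an endpoint that moves along the characteristic.\<close>
  have incr: "\<bar>(F s z - F t z) / (s - t) + l * (f t z - f t 0)\<bar>
      \<le> L2_norm (\<lambda>z. (1 / (s - t)) * (f s z - f t z) + l * q t z)"
    if s: "0 \<le> s" and t: "0 \<le> t" and z: "z \<in> {0..1}" for s t z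
  proof -
    have fi: "(f s has_integral F s z) {0..z}" if "0 \<le> s" for s
      unfolding F_def using z cont[OF that]
      by (intro integrable_integral integrable_continuous_real) (auto elim: continuous_on_subset)
    have "(q t has_integral (f t z - f t 0)) {0..z}"
      using reg[OF t] z by (auto simp: H1_deriv_def)
    then have "((\<lambda>z. (1 / (s - t)) * (f s z - f t z) + l * q t z) has_integral
        (1 / (s - t)) * (F s z - F t z) + l * (f t z - f t 0)) {0..z}"
      using fi[OF s] fi[OF t] by (intro has_integral_add has_integral_mult_right has_integral_diff)
    moreover have "square_integrable {0..1} (\<lambda>z. (1 / (s - t)) *\<^sub>R (f s z - f t z) + l *\<^sub>R q t z)"
      using reg[OF s] reg[OF t]
      by (intro square_integrable_add square_integrable_diff square_integrable_scaleR) (auto simp: H1_deriv_def)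
    ultimately show ?thesis
      using abs_integral_le_L2_norm[OF _ z, of "\<lambda>z. (1 / (s - t)) * (f s z - f t z) + l * q t z"]
      by (auto dest!: integral_unique)
  qed
  \<comment> \<open>Moving the endpoint contributes \<open>l * f (t + r) (a + l * r)\<close>, and
    the change in time cancels this up to \<open>l * f (t + r) 0\<close>, so the starting point
    \<open>a\<close> drops out.\<close>
  have derG: "((\<lambda>r. F (t + r) (a + l * r)) has_real_derivative l * f (t + r) 0) (at r within {0..r1})"
    if t: "0 \<le> t" and a: "0 \<le> a" "a + l * r1 \<le> 1" and r: "r \<in> {0..r1}" for t a r r1
  proof -
    define at_r where "at_r = at r within {0..r1}"
    have in01: "a + l * r' \<in> {0..1}" if "r' \<in> {0..r1}" for r'
    proof -
      have "l * r' \<le> l * r1" using that l by auto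
      moreover have "0 \<le> l * r'" using that l by auto
      ultimately show ?thesis using a by auto
    qed
    have tr: "0 \<le> t + r" using t r by auto
    have Y: "((\<lambda>r'. (F (t + r) (a + l * r') - F (t + r) (a + l * r)) / (r' - r))
        \<longlongrightarrow> f (t + r) (a + l * r) * l) at_r"
    proof -
      have "(F (t + r) has_real_derivative f (t + r) (a + l * r))
          (at (a + l * r) within (\<lambda>r'. a + l * r') ` {0..r1})"
        using derF[OF tr in01[OF r]] by (rule DERIV_subset) (use in01 in auto)
      moreover have "((\<lambda>r'. a + l * r') has_real_derivative l) (at r within {0..r1})"
        by (auto intro!: derivative_eq_intros)
      ultimately have "(F (t + r) \<circ> (\<lambda>r'. a + l * r') has_real_derivative f (t + r) (a + l * r) * l)
          (at r within {0..r1})"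
        by (rule DERIV_image_chain)
      then show ?thesis by (simp add: has_field_derivative_iff at_r_def)
    qed
    have shift: "filterlim (\<lambda>r'. t + r') (at (t + r) within {0..}) at_r"
      unfolding filterlim_at at_r_def using t
      by (auto intro!: tendsto_intros simp: eventually_at_filter)
    have X: "((\<lambda>r'. (F (t + r') (a + l * r') - F (t + r) (a + l * r')) / (r' - r)
        + l * (f (t + r) (a + l * r') - f (t + r) 0)) \<longlongrightarrow> 0) at_r"
    proof (rule Lim_null_comparison[OF _ filterlim_compose[OF eq[OF tr] shift]])
      show "\<forall>\<^sub>F r' in at_r. norm ((F (t + r') (a + l * r') - F (t + r) (a + l * r')) / (r' - r)
          + l * (f (t + r) (a + l * r') - f (t + r) 0))
        \<le> L2_norm (\<lambda>z. (1 / (t + r' - (t + r))) * (f (t + r') z - f (t + r) z) + l * q (t + r) z)"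
        unfolding at_r_def eventually_at_filter
      proof (intro always_eventually allI impI)
        fix r' assume r': "r' \<in> {0..r1}"
        then have "0 \<le> t + r'" using t by simp
        from incr[OF this tr in01[OF r']]
        show "norm ((F (t + r') (a + l * r') - F (t + r) (a + l * r')) / (r' - r)
            + l * (f (t + r) (a + l * r') - f (t + r) 0))
          \<le> L2_norm (\<lambda>z. (1 / (t + r' - (t + r))) * (f (t + r') z - f (t + r) z) + l * q (t + r) z)"
          by simp
      qed
    qed
    have "continuous_on {0..r1} (\<lambda>r'. f (t + r) (a + l * r'))"
      by (rule continuous_on_compose2[OF cont[OF tr]]) (use in01 in \<open>auto intro!: continuous_intros\<close>)
    then have Z: "((\<lambda>r'. f (t + r) (a + l * r')) \<longlongrightarrow> f (t + r) (a + l * r)) at_r"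
      using r by (auto simp: continuous_on_def at_r_def)
    have "((\<lambda>r'. (F (t + r') (a + l * r') - F (t + r) (a + l * r')) / (r' - r)
        + l * (f (t + r) (a + l * r') - f (t + r) 0)
        - l * (f (t + r) (a + l * r') - f (t + r) 0)
        + (F (t + r) (a + l * r') - F (t + r) (a + l * r)) / (r' - r))
        \<longlongrightarrow> 0 - l * (f (t + r) (a + l * r) - f (t + r) 0) + f (t + r) (a + l * r) * l) at_r"
      by (intro tendsto_intros X Y Z)
    then show ?thesis
      unfolding has_field_derivative_iff unfolding at_r_def[symmetric]
      by (simp add: diff_divide_distrib algebra_simps)
  qed
  have step: "f (t + r) (a + l * r) = f t a"
    if t: "0 \<le> t" and r: "0 \<le> r" "l * r < 1" and a: "0 \<le> a" "a + l * r \<le> 1" for t r a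
  proof -
    define b where "b = 1 - l * r"
    \<comment> \<open>The characteristics through \<open>x\<close> and through \<open>0\<close> give
      the same derivative, so the difference of the two primitives is constant in time.\<close>
    have F_eq: "F (t + r) (x + l * r) - F (t + r) (l * r) = F t x" if x: "x \<in> {0..b}" for x
    proof -
      have "\<exists>c. \<forall>r'\<in>{0..r}. F (t + r') (x + l * r') - F (t + r') (0 + l * r') = c"
        using x r t derG[of t x r] derG[of t 0 r] unfolding b_def
        by (intro has_field_derivative_zero_constant) (auto intro!: derivative_eq_intros)
      then have "F (t + r) (x + l * r) - F (t + r) (0 + l * r) = F (t + 0) (x + l * 0) - F (t + 0) (0 + l * 0)"
        using r by (metis atLeastAtMost_iff order_refl)
      then show ?thesis by (simp add: F_def)
    qed
    have ab: "a \<in> {0..b}" using a by (simp add: b_def)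
    have lr: "0 \<le> l * r" using l r by simp
    have sub: "(\<lambda>x. x + l * r) ` {0..b} \<subseteq> {0..1}" using l r by (auto simp: b_def)
    have "(F t has_real_derivative f t a) (at a within {0..b})"
      by (rule DERIV_subset[OF derF[OF t]]) (use ab lr in \<open>auto simp: b_def\<close>)
    moreover have "(F t has_real_derivative f (t + r) (a + l * r)) (at a within {0..b})"
    proof -
      have "a + l * r \<in> {0..1}" "0 \<le> t + r" using ab sub t r by auto
      then have "(F (t + r) has_real_derivative f (t + r) (a + l * r)) (at (a + l * r) within (\<lambda>x. x + l * r) ` {0..b})"
        using derF DERIV_subset sub by blast
      moreover have "((\<lambda>x. x + l * r) has_real_derivative 1) (at a within {0..b})"
        by (auto intro!: derivative_eq_intros)
      ultimately have "(F (t + r) \<circ> (\<lambda>x. x + l * r) has_real_derivative f (t + r) (a + l * r) * 1) (at a within {0..b})"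
        by (rule DERIV_image_chain)
      then have "((\<lambda>x. F (t + r) (x + l * r) - F (t + r) (l * r)) has_real_derivative f (t + r) (a + l * r))
          (at a within {0..b})"
        by (auto intro!: derivative_eq_intros simp: o_def)
      then show ?thesis
        by (rule has_field_derivative_transform_within[of _ _ _ _ 1]) (use F_eq ab in auto)
    qed
    moreover have "0 < b" using r by (simp add: b_def)
    ultimately show ?thesis
      using vector_derivative_unique_within_closed_interval[of 0 b a "F t" "f (t + r) (a + l * r)" "f t a"] ab
      unfolding has_real_derivative_iff_has_vector_derivative by simp
  qed
  show ?thesis
  proof (cases "l * r < 1")
    case True
    then show ?thesis by (rule step[OF assms(4,5) _ assms(6,7)])
  next
    case False
    \<comment> \<open>For \<open>l * r = 1\<close> the interval \<open>[0, 1 - l * r]\<close> is a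
      single point and determines no derivative, so the crossing is made in two halves.\<close>
    then have lr: "l * r = 1" "a = 0" using assms by auto
    have "f (t + r / 2 + r / 2) ((0 + l * (r / 2)) + l * (r / 2)) = f (t + r / 2) (0 + l * (r / 2))"
      using lr assms by (intro step) auto
    also have "\<dots> = f t 0"
      using lr assms by (intro step) auto
    finally show ?thesis using lr by (simp add: add.commute)
  qed
qed

section \<open>Block matrices\<close>

definition block_vec :: "real^'a \<Rightarrow> real^'b \<Rightarrow> real^('a + 'b)" where
  "block_vec x y = (\<chi> i. case i of Inl a \<Rightarrow> x $ a | Inr b \<Rightarrow> y $ b)"

lemma sum_UNIV_Plus:
  "(\<Sum>i\<in>UNIV. f i) = (\<Sum>a\<in>UNIV. f (Inl a)) + (\<Sum>b\<in>UNIV. f (Inr b))"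
  for f :: "'a::finite + 'b::finite \<Rightarrow> 'c::comm_monoid_add"
  using sum.Plus[of "UNIV :: 'a set" "UNIV :: 'b set" f] by simp

lemma block_row_mult: "(A ||| B) *v block_vec x y = A *v x + B *v y"
  by (simp add: vec_eq_iff matrix_vector_mult_def block_row_def block_vec_def sum_UNIV_Plus)

lemma block_col_mult: "(A --- B) *v x = block_vec (A *v x) (B *v x)"
  by (auto simp: vec_eq_iff matrix_vector_mult_def block_col_def block_vec_def split: sum.split)

lemma inner_block_vec: "block_vec x y \<bullet> block_vec x' y' = x \<bullet> x' + y \<bullet> y'"
  by (simp add: inner_vec_def block_vec_def sum_UNIV_Plus)

lemma block_vec_eq_0_iff: "block_vec x y = 0 \<longleftrightarrow> x = 0 \<and> y = 0"
  using inner_block_vec[of x y x y] inner_ge_zero[of x] inner_ge_zero[of y]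
  by (metis add_nonneg_eq_0_iff inner_eq_zero_iff)

text \<open>Transposed blocks are evaluated as \<open>y v* A\<close>; moving them across the inner
  product lets them merge with their mirror images in a block quadratic form.\<close>

lemma inner_vector_matrix_mult: "x \<bullet> (y v* A) = (A *v x) \<bullet> y" for A :: "real^'n^'m"
  using dot_lmul_matrix[of y A x] by (simp add: inner_commute)

lemma diagonal_matrix_mult: 
  assumes "diagonal_matrix A" shows "(A *v x) $ i = A $ i $ i * x $ i"
proof -
  have "(\<Sum>j\<in>UNIV. A $ i $ j * x $ j) = (\<Sum>j\<in>UNIV. if j = i then A $ i $ i * x $ i else 0)"
    using assms by (intro sum.cong) (auto simp: diagonal_matrix_def)
  then show ?thesis by (simp add: matrix_vector_mult_def)
qed

lemma pos_def_diagonal_pos: 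
  assumes "pos_def A" shows "0 < A $ i $ i"
proof -
  have "0 < axis i 1 \<bullet> (A *v axis i 1)"
    using assms unfolding pos_def_def by (simp add: axis_eq_0_iff)
  then show ?thesis by (simp add: inner_axis' matrix_vector_mul_component inner_axis)
qed

lemma matrix_vector_mult_uminus: "(- A) *v x = - (A *v x)" for A :: "real^'n^'m"
  by (simp add: vec_eq_iff matrix_vector_mult_def sum_negf)

lemmas block_simps = block_row_mult block_col_mult inner_block_vec inner_vector_matrix_mult
  matrix_vector_mult_uminus matrix_vector_mul_assoc[symmetric] matrix_vector_mult_add_rdistrib
  scaleR_matrix_vector_assoc[symmetric] matrix_vector_mul_lid

section \<open>The quadratic form of the LMI\<close>

lemma matrix_vector_mult_neg_right: "A *v (- x) = - (A *v x)" for A :: "real^'n^'m"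
  by (simp add: linear_neg)

lemma continuous_on_matrix_vector_mult [continuous_intros]:
  "continuous_on S f \<Longrightarrow> continuous_on S (\<lambda>x. A *v f x)" for A :: "real^'n^'m"
  by (rule bounded_linear.continuous_on[OF matrix_vector_mul_bounded_linear])

locale lyapunov_LMI = coupled_system \<Lambda> H Bu Bv M Bw Dv K1 K2 R S
  for \<Lambda> :: "real^'n^'n" and H :: "real^'n^'n" and Bu :: "real^'u^'n" and Bv :: "real^'v^'n"
    and M :: "real^'v^'v" and Bw :: "real^'w^'v" and Dv :: "real^'v^'n"
    and K1 :: "real^'e^'u" and K2 :: "real^'n^'u" and R :: "real^'e^'e" and S :: "real^'n^'e" +
  fixes P1 P2 :: "real^'n^'n" and P3 :: "real^'e^'e" and P4 :: "real^'v^'v" and lam \<alpha> \<beta> :: real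
  assumes \<Lambda>_diagonal: "diagonal_matrix \<Lambda>" and \<Lambda>_pos: "pos_def \<Lambda>"
    and lam: "is_smallest_eigenvalue \<Lambda> lam"
    and \<alpha>: "\<alpha> > 0" and \<beta>: "\<beta> > 0" and rate: "2 * \<alpha> + \<beta> \<le> exp (-1) * lam"
    and P1_diagonal: "diagonal_matrix P1" and P1_pos: "pos_def P1"
    and P2_diagonal: "diagonal_matrix P2" and P2_pos: "pos_def P2"
    and P3_pos: "pos_def P3" and P4_pos: "pos_def P4"
    and LMI: "neg_def (LMI_matrix P1 P2 P3 P4 \<alpha> \<beta>)"
begin

definition l :: "'n \<Rightarrow> real" where "l i = \<Lambda> $ i $ i"
definition p1 :: "'n \<Rightarrow> real" where "p1 i = P1 $ i $ i"
definition p2 :: "'n \<Rightarrow> real" where "p2 i = P2 $ i $ i"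
text \<open>Twice the shift \<open>\<theta>\<close> of the LMI, so for symmetric \<open>P\<close>
  the term \<open>He (\<theta> *\<^sub>R P)\<close> contributes \<open>c *\<^sub>R P\<close>; it
  becomes the decay rate of \<open>V\<close>.\<close>

definition c :: real where "c = 2 * \<alpha> + \<beta>"

definition inflow :: "real^'n \<Rightarrow> real^'e \<Rightarrow> real^'v \<Rightarrow> real^'n" where
  "inflow a e v = H *v a + Bu *v (K1 *v e + K2 *v (a + Dv *v v)) + Bv *v v"

text \<open>The value of \<open>d/dt (\<xi> t 0) = - \<Lambda> \<xi>z t 0\<close> prescribed by the boundary condition.\<close>

definition inflow_rate :: "real^'n \<Rightarrow> real^'n \<Rightarrow> real^'e \<Rightarrow> real^'v \<Rightarrow> real^'w \<Rightarrow> real^'n" where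
  "inflow_rate b a e v w =
     inflow (- (\<Lambda> *v b)) (R *v e + S *v (a + Dv *v v)) (M *v v + Bw *v w)"

text \<open>The rate at which \<open>exp (c * t) * V\<close> is supplied, up to the exponential
  factor. Here \<open>a\<close> and \<open>b\<close> are the outflow traces of \<xi> and
  \<open>\<xi>z\<close>; the inflow trace of \<open>\<xi>z\<close> is
  \<open>- inflow_rate / l\<close> by the transport equation. The transport terms carry no summand
  with \<open>c\<close>, since there the decay of the weight absorbs the rate.\<close>

definition dissipation :: "real^'n \<Rightarrow> real^'n \<Rightarrow> real^'e \<Rightarrow> real^'v \<Rightarrow> real^'w \<Rightarrow> real" where
  "dissipation b a e v w =
     (\<Sum>i\<in>UNIV. p1 i * (l i * (inflow a e v $ i)\<^sup>2 - l i * exp (-1) * (a $ i)\<^sup>2))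
     + (\<Sum>i\<in>UNIV. p2 i * (l i * (- (inflow_rate b a e v w $ i / l i))\<^sup>2 - l i * exp (-1) * (b $ i)\<^sup>2))
     + (c * (e \<bullet> (P3 *v e)) + 2 * (e \<bullet> (P3 *v (R *v e + S *v (a + Dv *v v)))))
     + (c * (v \<bullet> (P4 *v v)) + 2 * (v \<bullet> (P4 *v (M *v v + Bw *v w))))"

lemma l_pos: "0 < l i" and p1_pos: "0 < p1 i" and p2_pos: "0 < p2 i"
  by (simp_all add: l_def p1_def p2_def pos_def_diagonal_pos \<Lambda>_pos P1_pos P2_pos)

lemma l_neq_0 [simp]: "l i \<noteq> 0" using l_pos[of i] by simp

lemma c_pos: "0 < c" using \<alpha> \<beta> by (simp add: c_def)

text \<open>Coordinate vectors are eigenvectors of a diagonal matrix, so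
  \<open>lam \<le> l i\<close>; positivity of \<open>c\<close> makes \<open>lam\<close> positive,
  and then \<open>exp (-1) * lam \<le> lam\<close>. This is the rate bound that
  \<open>transport_energy_step\<close> requires.\<close>

lemma c_le: "c \<le> l i"
proof -
  have "\<Lambda> *v axis i 1 = l i *s axis i 1"
    by (auto simp: vec_eq_iff diagonal_matrix_mult[OF \<Lambda>_diagonal] l_def axis_def)
  then have "is_eigenvalue \<Lambda> (l i)"
    unfolding is_eigenvalue_def by (intro exI[of _ "axis i 1"]) (simp add: axis_eq_0_iff)
  then have lam_le: "lam \<le> l i" using lam by (auto simp: is_smallest_eigenvalue_def)
  have "0 < exp (-1) * lam" using c_pos rate by (simp add: c_def)
  then have "0 < lam" by (simp add: zero_less_mult_iff)
  moreover have "exp (-1) \<le> (1::real)" by simp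
  ultimately have "exp (-1) * lam \<le> 1 * lam" by (intro mult_right_mono) auto
  then show ?thesis using rate lam_le by (simp add: c_def)
qed

lemmas diagonal_simps = diagonal_matrix_mult[OF \<Lambda>_diagonal, folded l_def]
  diagonal_matrix_mult[OF P1_diagonal, folded p1_def] diagonal_matrix_mult[OF P2_diagonal, folded p2_def]

lemma inner_P3_commute: "(P3 *v x) \<bullet> y = x \<bullet> (P3 *v y)"
proof -
  have "y v* P3 = P3 *v y" using P3_pos by (metis pos_def_def transpose_matrix_vector)
  then show ?thesis using inner_vector_matrix_mult[of x y P3] by simp
qed

lemma inner_P4_commute: "(P4 *v x) \<bullet> y = x \<bullet> (P4 *v y)"
proof -
  have "y v* P4 = P4 *v y" using P4_pos by (metis pos_def_def transpose_matrix_vector)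
  then show ?thesis using inner_vector_matrix_mult[of x y P4] by simp
qed

text \<open>The Schur complement: the LMI is tested at \<open>(\<zeta>, \<Phi>a \<zeta>, \<Lambda>\<^sup>-\<^sup>1 \<Phi>b \<zeta>)\<close>. Taking \<open>w = 0\<close> in \<open>\<zeta>\<close>
  makes the last block of \<open>\<Phi>b\<close> irrelevant.\<close>

lemma dissipation_neg:
  assumes "(b, a, e, v) \<noteq> 0"
  shows "dissipation b a e v 0 < 0"
proof -
  define \<zeta> where "\<zeta> = block_vec b (block_vec a (block_vec e (block_vec v (0 :: real^'w))))"
  define x where "x = inflow a e v"
  define y where "y = (\<chi> i. - (inflow_rate b a e v 0 $ i / l i))"
  have \<Phi>a: "\<Phi>a *v \<zeta> = x"
    by (simp add: \<zeta>_def \<Phi>a_def x_def inflow_def block_simps matrix_vector_right_distrib)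
  have "\<Lambda> *v y = - inflow_rate b a e v 0"
    using l_pos by (simp add: vec_eq_iff diagonal_simps y_def)
  then have \<Phi>b: "\<Phi>b *v \<zeta> = \<Lambda> *v y"
    by (simp add: \<zeta>_def \<Phi>b_def inflow_rate_def inflow_def block_simps matrix_vector_right_distrib
        matrix_vector_mult_neg_right matrix_vector_mult_diff_distrib matrix_vector_mult_diff_rdistrib)
  have \<Psi>: "\<zeta> \<bullet> (\<Psi>a P1 P2 P3 P4 \<alpha> \<beta> *v \<zeta>) =
      - (exp (-1) * (b \<bullet> (\<Lambda> *v (P2 *v b)))) - exp (-1) * (a \<bullet> (\<Lambda> *v (P1 *v a)))
      + (c * (e \<bullet> (P3 *v e)) + 2 * (e \<bullet> (P3 *v (R *v e + S *v (a + Dv *v v)))))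
      + (c * (v \<bullet> (P4 *v v)) + 2 * (v \<bullet> (P4 *v (M *v v))))"
    unfolding \<Psi>a_def Let_def \<zeta>_def He_def
    by (simp add: block_simps matrix_vector_right_distrib inner_add_right inner_add_left c_def
        inner_P3_commute inner_P4_commute algebra_simps inner_commute)
  have "block_vec \<zeta> (block_vec x y) \<noteq> 0"
    using assms by (auto simp: \<zeta>_def block_vec_eq_0_iff zero_prod_def)
  then have "block_vec \<zeta> (block_vec x y) \<bullet> (LMI_matrix P1 P2 P3 P4 \<alpha> \<beta> *v block_vec \<zeta> (block_vec x y)) < 0"
    using LMI by (simp add: neg_def_def)
  \<comment> \<open>Each off-diagonal block occurs twice and the matching diagonal block is
    subtracted once. Since \<open>\<Phi>a *v \<zeta> = x\<close> and
    \<open>\<Phi>b *v \<zeta> = \<Lambda> *v y\<close>, one positive copy of each remains.\<close>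
  then have "\<zeta> \<bullet> (\<Psi>a P1 P2 P3 P4 \<alpha> \<beta> *v \<zeta>) + x \<bullet> (P1 *v (\<Lambda> *v x)) + y \<bullet> (P2 *v (\<Lambda> *v y)) < 0"
    unfolding LMI_matrix_def
    by (simp add: block_simps \<Phi>a \<Phi>b inner_add_right inner_commute)
  moreover have "x \<bullet> (P1 *v (\<Lambda> *v x)) = (\<Sum>i\<in>UNIV. p1 i * (l i * (x $ i)\<^sup>2))"
    "y \<bullet> (P2 *v (\<Lambda> *v y)) = (\<Sum>i\<in>UNIV. p2 i * (l i * (y $ i)\<^sup>2))"
    "a \<bullet> (\<Lambda> *v (P1 *v a)) = (\<Sum>i\<in>UNIV. p1 i * (l i * (a $ i)\<^sup>2))"
    "b \<bullet> (\<Lambda> *v (P2 *v b)) = (\<Sum>i\<in>UNIV. p2 i * (l i * (b $ i)\<^sup>2))"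
    by (simp_all add: inner_vec_def diagonal_simps power2_eq_square mult_ac)
  ultimately show ?thesis
    unfolding \<Psi> dissipation_def
    by (simp add: x_def y_def sum_subtractf right_diff_distrib sum_distrib_left mult_ac)
qed

lemma dissipation_le: "\<exists>C>0. \<forall>b a e v w. dissipation b a e v w \<le> C * (w \<bullet> w)"
proof -
  \<comment> \<open>With \<open>w\<close> split off as the second component,
    \<open>snd z \<bullet> snd z\<close> vanishes exactly when \<open>w = 0\<close>, the case of
    \<open>dissipation_neg\<close>.\<close>
  define q where "q = (\<lambda>((b, a, e, v), w). dissipation b a e v w)"
  have cont: "continuous_on UNIV q"
    unfolding q_def dissipation_def inflow_rate_def inflow_def case_prod_unfold
    by (intro continuous_intros) simp
  have lin: "inflow (r *\<^sub>R a) (r *\<^sub>R e) (r *\<^sub>R v) = r *\<^sub>R inflow a e v"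
      "inflow_rate (r *\<^sub>R b) (r *\<^sub>R a) (r *\<^sub>R e) (r *\<^sub>R v) (r *\<^sub>R w) = r *\<^sub>R inflow_rate b a e v w"
    for r b a e v w
    by (simp_all add: inflow_rate_def inflow_def matrix_vector_mult_scaleR scaleR_add_right[symmetric]
        scaleR_minus_right[symmetric] del: scaleR_minus_right scaleR_add_right)
  have "dissipation (r *\<^sub>R b) (r *\<^sub>R a) (r *\<^sub>R e) (r *\<^sub>R v) (r *\<^sub>R w) = r\<^sup>2 * dissipation b a e v w"
    for r b a e v w
    by (simp add: dissipation_def lin matrix_vector_mult_scaleR scaleR_add_right[symmetric]
        power_mult_distrib power_divide sum_distrib_left algebra_simps power2_eq_square
        del: scaleR_add_right)
  then have hom: "q (r *\<^sub>R z) = r\<^sup>2 * q z" for r z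
    by (simp add: q_def case_prod_unfold)
  have neg: "q (x, 0) < 0" if "x \<noteq> 0" for x
    using dissipation_neg that by (cases x) (simp add: q_def)
  have "\<exists>C>0. \<forall>z. q z \<le> C * (snd z \<bullet> snd z)"
  proof (rule quadratic_form_le[OF cont _ hom])
    show "q z < 0" if "z \<noteq> 0" "snd z \<bullet> snd z = 0" for z
      using neg[of "fst z"] that by (cases z) (auto simp: zero_prod_def)
  qed (auto intro!: continuous_intros simp: power2_eq_square)
  then show ?thesis by (simp add: q_def)
qed

end

section \<open>The Lyapunov inequality along solutions\<close>

lemma has_integral_matrix_vector_mult:
  "(f has_integral I) A \<Longrightarrow> ((\<lambda>x. B *v f x) has_integral B *v I) A" for B :: "real^'n^'m"
  using has_integral_linear[OF _ matrix_vector_mul_bounded_linear, of f I A B] by (simp add: o_def)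

lemma has_integral_vec_nth:
  "(f has_integral I) A \<Longrightarrow> ((\<lambda>x. f x $ i) has_integral I $ i) A" for f :: "real \<Rightarrow> real^'n"
  using has_integral_linear[OF _ bounded_linear_vec_nth, of f I A i] by (simp add: o_def)

lemma has_integral_vecI:
  fixes f :: "real \<Rightarrow> real^'n"
  assumes "\<And>i. ((\<lambda>x. f x $ i) has_integral I $ i) A"
  shows "(f has_integral I) A"
  using assms unfolding has_integral_componentwise_iff[of f]
  by (auto simp: Basis_vec_def inner_axis)

lemma has_integral_shift_to_0:
  fixes f :: "real \<Rightarrow> 'a::banach"
  assumes "(f has_integral I) {t..t + s}"
  shows "((\<lambda>x. f (t + x)) has_integral I) {0..s}"
  using has_integral_affinity'[OF assms[folded box_real], of 1 t] by (simp add: add.commute)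

lemma H1_deriv_vec_nth:
  fixes f g :: "real \<Rightarrow> real^'n"
  shows "H1_deriv f g \<Longrightarrow> H1_deriv (\<lambda>z. f z $ i) (\<lambda>z. g z $ i)"
  unfolding H1_deriv_def vector_minus_component[symmetric]
  by (auto intro!: square_integrable_linear[OF bounded_linear_vec_nth] has_integral_vec_nth
      simp del: vector_minus_component)

lemma weighted_energy_integrable:
  fixes f :: "real \<Rightarrow> real^'n"
  assumes "square_integrable {0..1} f"
  shows "(\<lambda>z. exp (- z) * (f z $ i)\<^sup>2) integrable_on {0..1}"
proof -
  have "square_integrable {0..1} (\<lambda>z. f z $ i)"
    by (rule square_integrable_linear[OF bounded_linear_vec_nth assms]) auto
  then have "(\<lambda>z. exp (- z) * (f z $ i)\<^sup>2) absolutely_integrable_on {0..1}"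
    by (intro absolutely_integrable_continuous_mult continuous_intros)
      (simp add: square_integrable_def power2_eq_square)
  then show ?thesis by (simp add: absolutely_integrable_on_def)
qed

text \<open>Kept as a sum over components because each travels at its own speed; with the diagonal
  of \<open>P\<close> as weights it is an integral term of \<open>V\<close>.\<close>

definition energy :: "('n::finite \<Rightarrow> real) \<Rightarrow> (real \<Rightarrow> real^'n) \<Rightarrow> real" where
  "energy p f = (\<Sum>i\<in>UNIV. p i * integral {0..1} (\<lambda>z. exp (- z) * (f z $ i)\<^sup>2))"

lemma weighted_diagonal_integral:
  fixes f :: "real \<Rightarrow> real^'n"
  assumes P: "diagonal_matrix P" and f: "square_integrable {0..1} f"
  shows "((\<lambda>z. exp (- z) * (f z \<bullet> (P *v f z))) has_integral energy (\<lambda>i. P $ i $ i) f) {0..1}"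
proof -
  have eq: "exp (- z) * (f z \<bullet> (P *v f z)) = (\<Sum>i\<in>UNIV. P $ i $ i * (exp (- z) * (f z $ i)\<^sup>2))" for z
    by (simp add: inner_vec_def diagonal_matrix_mult[OF P] sum_distrib_left power2_eq_square mult_ac)
  show ?thesis
    unfolding eq energy_def
    by (intro has_integral_sum has_integral_mult_right integrable_integral weighted_energy_integrable f) auto
qed

text \<open>Nonnegativity of the integrand makes gauge integrability absolute, so the Lebesgue
  integral in \<open>V\<close> agrees with the gauge integral used for the estimates.\<close>

lemma weighted_diagonal_LINT:
  fixes f :: "real \<Rightarrow> real^'n"
  assumes "diagonal_matrix P" and P: "pos_def P" and "square_integrable {0..1} f"
  shows "(LINT z:{0..1}|lebesgue. exp (- z) * (f z \<bullet> (P *v f z))) = energy (\<lambda>i. P $ i $ i) f"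
proof -
  note int = weighted_diagonal_integral[OF assms(1,3)]
  have "0 \<le> x \<bullet> (P *v x)" for x
    using P by (cases "x = 0") (auto simp: pos_def_def less_imp_le)
  then have "(\<lambda>z. exp (- z) * (f z \<bullet> (P *v f z))) absolutely_integrable_on {0..1}"
    using int by (intro nonnegative_absolutely_integrable_1) auto
  then show ?thesis
    using int by (simp add: set_lebesgue_integral_eq_integral integral_unique)
qed

locale lyapunov_solution = lyapunov_LMI \<Lambda> H Bu Bv M Bw Dv K1 K2 R S P1 P2 P3 P4 lam \<alpha> \<beta>
  for \<Lambda> :: "real^'n^'n" and H :: "real^'n^'n" and Bu :: "real^'u^'n" and Bv :: "real^'v^'n"
    and M :: "real^'v^'v" and Bw :: "real^'w^'v" and Dv :: "real^'v^'n"
    and K1 :: "real^'e^'u" and K2 :: "real^'n^'u" and R :: "real^'e^'e" and S :: "real^'n^'e"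
    and P1 P2 :: "real^'n^'n" and P3 :: "real^'e^'e" and P4 :: "real^'v^'v" and lam \<alpha> \<beta> :: real +
  fixes w :: "real \<Rightarrow> real^'w" and \<xi> \<xi>z :: "real \<Rightarrow> real \<Rightarrow> real^'n"
    and v :: "real \<Rightarrow> real^'v" and \<eta> :: "real \<Rightarrow> real^'e"
  assumes sol: "is_solution w \<xi> \<xi>z v \<eta>" and w: "w \<in> disturbances"
begin

lemma reg: "0 \<le> t \<Longrightarrow> H1_deriv (\<xi> t) (\<xi>z t)"
  and transport: "0 \<le> t \<Longrightarrow>
    ((\<lambda>s. L2_norm (\<lambda>z. (1 / (s - t)) *\<^sub>R (\<xi> s z - \<xi> t z) - (- (\<Lambda> *v \<xi>z t z)))) \<longlongrightarrow> 0) (at t within {0..})"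
  and boundary: "0 \<le> t \<Longrightarrow> \<xi> t 0 = inflow (\<xi> t 1) (\<eta> t) (v t)"
  and v_integral: "0 \<le> t \<Longrightarrow> ((\<lambda>s. M *v v s + Bw *v w s) has_integral (v t - v 0)) {0..t}"
  and \<eta>_deriv: "0 \<le> t \<Longrightarrow>
    (\<eta> has_vector_derivative (R *v \<eta> t + S *v (\<xi> t 1 + Dv *v v t))) (at t within {0..})"
  using sol unfolding is_solution_def Let_def inflow_def by blast+

lemma sq_int: "0 \<le> t \<Longrightarrow> square_integrable {0..1} (\<xi> t)" "0 \<le> t \<Longrightarrow> square_integrable {0..1} (\<xi>z t)"
  using reg by (auto simp: H1_deriv_def)

lemma w_bounded: "0 \<le> t \<Longrightarrow> norm (w t) \<le> 1"
  using w unfolding disturbances_def by (auto simp: norm_eq_sqrt_inner)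

text \<open>Since \<open>\<Lambda>\<close> is diagonal, the components decouple into scalar
  transport equations; taking a component does not increase the L2 norm, so the limit of the
  difference quotients is inherited.\<close>

lemma characteristics:
  assumes "0 \<le> t" "0 \<le> r" "0 \<le> a" "a + l i * r \<le> 1"
  shows "\<xi> (t + r) (a + l i * r) $ i = \<xi> t a $ i"
proof (rule transport_constant_on_characteristics[where q = "\<lambda>t z. \<xi>z t z $ i", OF l_pos _ _ assms])
  fix t :: real assume t: "0 \<le> t"
  show "H1_deriv (\<lambda>z. \<xi> t z $ i) (\<lambda>z. \<xi>z t z $ i)"
    using reg[OF t] by (rule H1_deriv_vec_nth)
  define d where "d s z = (1 / (s - t)) *\<^sub>R (\<xi> s z - \<xi> t z) - (- (\<Lambda> *v \<xi>z t z))" for s z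
  have d_sq: "square_integrable {0..1} (d s)" if "0 \<le> s" for s
    unfolding d_def using sq_int t that
    by (intro square_integrable_diff square_integrable_scaleR square_integrable_linear[of uminus]
        square_integrable_linear[OF matrix_vector_mul_bounded_linear]) (auto intro: bounded_linear_minus)
  have "((\<lambda>s. L2_norm (\<lambda>z. d s z $ i)) \<longlongrightarrow> 0) (at t within {0..})"
  proof (rule Lim_null_comparison)
    show "((\<lambda>s. L2_norm (d s)) \<longlongrightarrow> 0) (at t within {0..})"
      using transport[OF t] by (simp add: d_def[abs_def])
    show "\<forall>\<^sub>F s in at t within {0..}. norm (L2_norm (\<lambda>z. d s z $ i)) \<le> L2_norm (d s)"
      unfolding eventually_at_filter
    proof (intro always_eventually allI impI)
      fix s :: real assume "s \<in> {0..}"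
      then show "norm (L2_norm (\<lambda>z. d s z $ i)) \<le> L2_norm (d s)"
        using L2_norm_linear_le[OF d_sq bounded_linear_vec_nth, of s i] L2_norm_nonneg[of "\<lambda>z. d s z $ i"]
        by (auto simp: component_le_norm_cart)
    qed
  qed
  then show "((\<lambda>s. L2_norm (\<lambda>z. (1 / (s - t)) * (\<xi> s z $ i - \<xi> t z $ i) + l i * \<xi>z t z $ i))
      \<longlongrightarrow> 0) (at t within {0..})"
    by (simp add: d_def diagonal_simps)
qed

end

lemma bounded_image_continuous:
  fixes f :: "real \<Rightarrow> 'a::real_normed_vector"
  shows "continuous_on {a..b} f \<Longrightarrow> bounded (f ` {a..b})"
  by (intro compact_imp_bounded compact_continuous_image) auto

text \<open>The product rule is used twice, for \<open>f \<bullet> (P *v f)\<close> and for its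
  product with \<open>exp (c * s)\<close>; symmetry of \<open>P\<close> merges the two cross terms.
  The primitive form covers \<open>v\<close>, whose derivative is only a bounded integrand.\<close>

lemma weighted_quadratic_integral:
  fixes f f' :: "real \<Rightarrow> real^'m" and P :: "real^'m^'m" and c :: real
  assumes h: "0 \<le> h" and f: "\<And>s. s \<in> {0..h} \<Longrightarrow> (f' has_integral (f s - f 0)) {0..s}"
    and bdd: "bounded (f' ` {0..h})" and P: "\<And>x y. (P *v x) \<bullet> y = x \<bullet> (P *v y)"
  shows "((\<lambda>s. exp (c * s) * (c * (f s \<bullet> (P *v f s)) + 2 * (f s \<bullet> (P *v f' s)))) has_integral
           (exp (c * h) * (f h \<bullet> (P *v f h)) - f 0 \<bullet> (P *v f 0))) {0..h}"
proof -
  define \<phi> where "\<phi> s = f s \<bullet> (P *v f s)" for s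
  define \<phi>' where "\<phi>' s = f' s \<bullet> (P *v f s) + f s \<bullet> (P *v f' s)" for s
  have Pf: "((\<lambda>s. P *v f' s) has_integral (P *v f s - P *v f 0)) {0..s}" if "s \<in> {0..h}" for s
    using has_integral_matrix_vector_mult[OF f[OF that], of P] by (simp add: matrix_vector_mult_diff_distrib)
  have bP: "bounded ((\<lambda>s. P *v f' s) ` {0..h})"
    using bounded_linear_image[OF bdd matrix_vector_mul_bounded_linear[of P]] by (simp add: image_image)
  have \<phi>: "(\<phi>' has_integral (\<phi> s - \<phi> 0)) {0..s}" if s: "s \<in> {0..h}" for s
  proof -
    have "{0..s} \<subseteq> {0..h}" using s by auto
    then have "bounded (f' ` {0..s})" "bounded ((\<lambda>s. P *v f' s) ` {0..s})"
      using bdd bP by (meson bounded_subset image_mono)+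
    then show ?thesis unfolding \<phi>_def \<phi>'_def
      using s by (intro has_integral_bilinear_Lipschitz[OF bounded_bilinear_inner _ f Pf]) auto
  qed
  have "bounded (\<phi>' ` {0..h})"
  proof -
    obtain K where K: "\<And>s. s \<in> {0..h} \<Longrightarrow> norm (f' s) \<le> K"
      using bdd unfolding bounded_iff by blast
    obtain L where L: "\<And>s. s \<in> {0..h} \<Longrightarrow> norm (P *v f s) \<le> L"
      using bounded_image_continuous[OF continuous_on_primitive[OF Pf]] unfolding bounded_iff by blast
    have "\<bar>\<phi>' s\<bar> \<le> 2 * (K * L)" if s: "s \<in> {0..h}" for s
    proof -
      have "\<phi>' s = 2 * (f' s \<bullet> (P *v f s))"
        using P[of "f s" "f' s"] by (simp add: \<phi>'_def inner_commute)
      moreover have "\<bar>f' s \<bullet> (P *v f s)\<bar> \<le> K * L"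
        using Cauchy_Schwarz_ineq2[of "f' s" "P *v f s"] mult_mono[OF K[OF s] L[OF s]] order_trans[OF norm_ge_zero K[OF s]]
        by simp
      ultimately show ?thesis by (simp add: abs_mult)
    qed
    then show ?thesis by (intro boundedI[of _ "2 * (K * L)"]) auto
  qed
  moreover have "((\<lambda>s. c * exp (c * s)) has_integral (exp (c * s) - exp (c * 0))) {0..s}" if "s \<in> {0..h}" for s
    using that by (intro fundamental_theorem_of_calculus)
      (auto intro!: derivative_eq_intros simp flip: has_real_derivative_iff_has_vector_derivative)
  moreover have "bounded ((\<lambda>s. c * exp (c * s)) ` {0..h})"
    by (intro bounded_image_continuous continuous_intros)
  ultimately have "((\<lambda>s. c * exp (c * s) * \<phi> s + exp (c * s) * \<phi>' s) has_integral
      (exp (c * h) * \<phi> h - exp (c * 0) * \<phi> 0)) {0..h}"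
    using \<phi> by (intro has_integral_bilinear_Lipschitz[OF bounded_bilinear_mult h]) auto
  moreover have "c * exp (c * s) * \<phi> s + exp (c * s) * \<phi>' s
      = exp (c * s) * (c * (f s \<bullet> (P *v f s)) + 2 * (f s \<bullet> (P *v f' s)))" for s
    using P[of "f s" "f' s"] by (simp add: \<phi>_def \<phi>'_def inner_commute algebra_simps)
  ultimately show ?thesis by (simp add: \<phi>_def)
qed

section \<open>Boundary traces and energies on a short time window\<close>

context lyapunov_solution
begin

context
  fixes t h :: real
  assumes t: "0 \<le> t" and h: "0 \<le> h" and lh: "\<And>i. l i * h \<le> 1"
begin

text \<open>The traces of the solution on the time window \<open>[t, t + h]\<close>. The trace \<open>b\<close> of \<open>\<xi>z\<close> at the
  outflow boundary is not defined pointwise in time for an \<open>L\<^sup>2\<close> function, so it is read off the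
  profile at time \<open>t\<close> along the characteristics.\<close>

definition "a s = \<xi> (t + s) 1"
definition "b s = (\<chi> i. \<xi>z t (1 - l i * s) $ i)"
definition "e s = \<eta> (t + s)"
definition "vv s = v (t + s)"
definition "ww s = w (t + s)"
definition "e' s = R *v e s + S *v (a s + Dv *v vv s)"
definition "v' s = M *v vv s + Bw *v ww s"
definition "X s = inflow_rate (b s) (a s) (e s) (vv s) (ww s)"

lemma ls: "s \<in> {0..h} \<Longrightarrow> 0 \<le> l i * s \<and> l i * s \<le> 1"
  using l_pos[of i] order_trans[OF mult_left_mono[of s h "l i"] lh] by auto

text \<open>What reaches the outflow end after time \<open>s\<close> was at
  \<open>1 - l i * s\<close> at time \<open>t\<close>.\<close>

lemma a_nth: "s \<in> {0..h} \<Longrightarrow> a s $ i = \<xi> t (1 - l i * s) $ i"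
  using characteristics[OF t, of s "1 - l i * s" i] ls[of s i] by (simp add: a_def)

lemma v_primitive: 
  assumes s: "s \<in> {0..h}" shows "(v' has_integral (vv s - vv 0)) {0..s}"
proof -
  define g where "g s = M *v v s + Bw *v w s" for s
  have 1: "(g has_integral (v (t + s) - v 0)) {0..t + s}" and 2: "(g has_integral (v t - v 0)) {0..t}"
    using v_integral[of "t + s"] v_integral[of t] t s by (simp_all add: g_def[abs_def])
  have "(g has_integral (v (t + s) - v t)) {t..t + s}"
    using has_integral_tail[OF 1 2] t s by simp
  from has_integral_shift_to_0[OF this] show ?thesis
    by (simp add: g_def v'_def[abs_def] vv_def ww_def)
qed

lemma v_cont: "continuous_on {0..h} vv"
  by (rule continuous_on_primitive[OF v_primitive])

text \<open>The pointwise bound on \<open>w\<close> enters here, because the product rule asks for a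
  bounded integrand.\<close>

lemma v'_bounded: "bounded (v' ` {0..h})"
proof -
  obtain K where K: "\<And>x. norm (Bw *v x) \<le> norm x * K" "0 \<le> K"
    using bounded_linear.nonneg_bounded[OF matrix_vector_mul_bounded_linear[of Bw]] by auto
  have "norm (Bw *v ww s) \<le> K" if "s \<in> {0..h}" for s
    using K(1)[of "ww s"] mult_right_mono[OF w_bounded[of "t + s"] K(2)] that t by (simp add: ww_def)
  then have "bounded ((\<lambda>s. Bw *v ww s) ` {0..h})" by (intro boundedI[of _ K]) auto
  moreover have "bounded ((\<lambda>s. M *v vv s) ` {0..h})"
    by (intro bounded_image_continuous continuous_intros v_cont)
  ultimately show ?thesis unfolding v'_def[abs_def] by (intro bounded_plus_comp)
qed

lemma a_cont: "continuous_on {0..h} a"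
proof -
  have "continuous_on {0..h} (\<lambda>s. \<xi> t (1 - l i * s) $ i)" for i
    by (intro continuous_on_component continuous_on_compose2[OF H1_deriv_continuous[OF reg[OF t]]])
      (use ls in \<open>auto intro!: continuous_intros\<close>)
  then have "continuous_on {0..h} (\<lambda>s. \<chi> i. \<xi> t (1 - l i * s) $ i)"
    by (rule continuous_on_vec_lambda)
  then show ?thesis
    by (rule continuous_on_eq) (simp add: vec_eq_iff a_nth)
qed

lemma e_deriv: 
  assumes "s \<in> {0..h}" shows "(e has_vector_derivative e' s) (at s within {0..h})"
proof -
  have "((\<lambda>s. t + s) has_vector_derivative 1) (at s within {0..h})"
    by (auto intro!: derivative_eq_intros)
  moreover have "(\<eta> has_vector_derivative e' s) (at (t + s) within (\<lambda>s. t + s) ` {0..h})"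
    using \<eta>_deriv[of "t + s"] assms t
    by (auto simp: e'_def e_def a_def vv_def intro: has_vector_derivative_within_subset)
  ultimately have "(\<eta> \<circ> (\<lambda>s. t + s) has_vector_derivative 1 *\<^sub>R e' s) (at s within {0..h})"
    by (rule vector_diff_chain_within)
  then show ?thesis by (simp add: o_def e_def[abs_def])
qed

lemma e_primitive: "s \<in> {0..h} \<Longrightarrow> (e' has_integral (e s - e 0)) {0..s}"
  by (intro fundamental_theorem_of_calculus) (auto intro!: has_vector_derivative_within_subset[OF e_deriv])

lemma e'_bounded: "bounded (e' ` {0..h})"
  unfolding e'_def[abs_def]
  by (intro bounded_image_continuous continuous_intros a_cont v_cont continuous_on_primitive[OF e_primitive])

text \<open>Time increments of the outflow trace are space increments of the profile at time
  \<open>t\<close>, which are integrals of \<open>\<xi>z t\<close>; the substitution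
  \<open>z = 1 - l i * s\<close> turns these into integrals of \<open>b\<close>.\<close>

lemma a_primitive: 
  assumes s: "s \<in> {0..h}" shows "((\<lambda>s. - (\<Lambda> *v b s)) has_integral (a s - a 0)) {0..s}"
proof (rule has_integral_vecI)
  fix i
  define z where "z = 1 - l i * s"
  have z: "0 \<le> z" "z \<le> 1" using ls[OF s, of i] by (auto simp: z_def)
  have H: "H1_deriv (\<lambda>z. \<xi> t z $ i) (\<lambda>z. \<xi>z t z $ i)" by (rule H1_deriv_vec_nth[OF reg[OF t]])
  have 1: "((\<lambda>z. \<xi>z t z $ i) has_integral \<xi> t 1 $ i - \<xi> t 0 $ i) {0..1}"
    and 2: "((\<lambda>z. \<xi>z t z $ i) has_integral \<xi> t z $ i - \<xi> t 0 $ i) {0..z}"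
    using H z by (auto simp: H1_deriv_def)
  have "((\<lambda>z. \<xi>z t z $ i) has_integral \<xi> t 1 $ i - \<xi> t z $ i) {z..1}"
    using has_integral_tail[OF 1 2 z] by simp
  from has_integral_reflect_affine[OF this l_pos[of i] z(2), of 1]
  have "((\<lambda>s. \<xi>z t (1 - l i * s) $ i) has_integral (\<xi> t 1 $ i - \<xi> t z $ i) /\<^sub>R l i) {0..s}"
    by (simp add: z_def)
  from has_integral_mult_right[OF this, of "- l i"]
  show "((\<lambda>s. (- (\<Lambda> *v b s)) $ i) has_integral (a s - a 0) $ i) {0..s}"
    using s h by (simp add: diagonal_simps b_def a_nth z_def flip: mult.assoc)
qed

text \<open>The boundary condition is linear, so the increment of \<open>\<xi> (t + s) 0\<close> is
  \<open>inflow\<close> of the increments of the traces, each of which has a known integrand. Thus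
  \<open>X\<close> is the weak time derivative of the inflow value.\<close>

lemma inflow_primitive: 
  assumes s: "s \<in> {0..h}" shows "(X has_integral (\<xi> (t + s) 0 - \<xi> t 0)) {0..s}"
proof -
  have "(X has_integral inflow (a s - a 0) (e s - e 0) (vv s - vv 0)) {0..s}"
    unfolding X_def[abs_def] inflow_rate_def inflow_def
    using a_primitive[OF s] e_primitive[OF s] v_primitive[OF s] unfolding e'_def[abs_def] v'_def[abs_def]
    by (intro has_integral_add has_integral_matrix_vector_mult)
  moreover have "inflow (a s - a 0) (e s - e 0) (vv s - vv 0) = \<xi> (t + s) 0 - \<xi> t 0"
    using boundary[OF t] boundary[of "t + s"] t s
    by (simp add: inflow_def a_def e_def vv_def matrix_vector_mult_diff_distrib matrix_vector_right_distrib)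
  ultimately show ?thesis by simp
qed

lemma \<xi>_energy:
  "(\<lambda>s. exp (c * s) * (inflow (a s) (e s) (vv s) $ i)\<^sup>2) integrable_on {0..h}"
  "(\<lambda>s. exp (c * s) * (a s $ i)\<^sup>2) integrable_on {0..h}"
  "exp (c * h) * integral {0..1} (\<lambda>z. exp (- z) * (\<xi> (t + h) z $ i)\<^sup>2) \<le>
    integral {0..1} (\<lambda>z. exp (- z) * (\<xi> t z $ i)\<^sup>2)
    + l i * integral {0..h} (\<lambda>s. exp (c * s) * (inflow (a s) (e s) (vv s) $ i)\<^sup>2)
    - l i * exp (-1) * integral {0..h} (\<lambda>s. exp (c * s) * (a s $ i)\<^sup>2)"
proof -
  define k where "k s = \<xi> (t + s) 0 $ i" for s
  have th: "0 \<le> t + h" using t h by simp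
  have out: "\<xi> (t + h) (z + l i * h) $ i = \<xi> t z $ i" if "z \<in> {0..1 - l i * h} - {}" for z
    using that by (intro characteristics t h) auto
  have inn: "\<xi> (t + h) z $ i = k (h - z / l i)" if "z \<in> {0..l i * h} - {}" for z
  proof -
    define s where "s = h - z / l i"
    have "z / l i \<le> h" "0 \<le> z / l i" using that l_pos[of i] by (auto simp: divide_le_eq mult.commute)
    then have "0 \<le> t + s" "0 \<le> z / l i" using t by (auto simp: s_def)
    moreover have "0 + l i * (z / l i) \<le> 1" using that lh[of i] by simp
    ultimately have "\<xi> (t + s + z / l i) (0 + l i * (z / l i)) $ i = \<xi> (t + s) 0 $ i"
      by (intro characteristics) auto
    then show ?thesis by (simp add: s_def k_def)
  qed
  \<comment> \<open>For the continuous \<xi> both transport identities hold everywhere, hence the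
    empty exceptional sets.\<close>
  note step = transport_energy_step[OF l_pos h lh less_imp_le[OF c_pos] c_le
      weighted_energy_integrable[OF sq_int(1)[OF t]] weighted_energy_integrable[OF sq_int(1)[OF th]]
      negligible_empty out negligible_empty inn]
  have k: "exp (c * s) * (k s)\<^sup>2 = exp (c * s) * (inflow (a s) (e s) (vv s) $ i)\<^sup>2" if "s \<in> {0..h}" for s
    using boundary[of "t + s"] t that by (simp add: k_def a_def e_def vv_def)
  have aa: "exp (c * s) * (\<xi> t (1 - l i * s) $ i)\<^sup>2 = exp (c * s) * (a s $ i)\<^sup>2" if "s \<in> {0..h}" for s
    using a_nth[OF that, of i] by simp
  show "(\<lambda>s. exp (c * s) * (inflow (a s) (e s) (vv s) $ i)\<^sup>2) integrable_on {0..h}"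
    by (rule integrable_eq[OF step(1) k])
  show "(\<lambda>s. exp (c * s) * (a s $ i)\<^sup>2) integrable_on {0..h}"
    by (rule integrable_eq[OF step(2) aa])
  show "exp (c * h) * integral {0..1} (\<lambda>z. exp (- z) * (\<xi> (t + h) z $ i)\<^sup>2) \<le>
    integral {0..1} (\<lambda>z. exp (- z) * (\<xi> t z $ i)\<^sup>2)
    + l i * integral {0..h} (\<lambda>s. exp (c * s) * (inflow (a s) (e s) (vv s) $ i)\<^sup>2)
    - l i * exp (-1) * integral {0..h} (\<lambda>s. exp (c * s) * (a s $ i)\<^sup>2)"
    using step(3) unfolding integral_cong[OF k, of "{0..h}" "\<lambda>s. s", simplified]
      integral_cong[OF aa, of "{0..h}" "\<lambda>s. s", simplified] .
qed

text \<open>Constancy of \<xi> along characteristics gives \<open>\<xi>z t\<close> and the shifted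
  \<open>\<xi>z (t + h)\<close> the same primitive, so they agree almost everywhere.\<close>

lemma \<xi>z_outflow:
  obtains N where "negligible N"
    "\<And>z. z \<in> {0..1 - l i * h} - N \<Longrightarrow> \<xi>z (t + h) (z + l i * h) $ i = \<xi>z t z $ i"
proof -
  have th: "0 \<le> t + h" using t h by simp
  have lh0: "0 \<le> l i * h" using l_pos[of i] h by simp
  have prim: "((\<lambda>z. \<xi>z (t + h) (l i * h + z) $ i) has_integral (\<xi> t z $ i - \<xi> t 0 $ i)) {0..z}"
    if z: "z \<in> {0..1 - l i * h}" for z
  proof -
    have H: "H1_deriv (\<lambda>z. \<xi> (t + h) z $ i) (\<lambda>z. \<xi>z (t + h) z $ i)"
      by (rule H1_deriv_vec_nth[OF reg[OF th]])
    have 1: "((\<lambda>z. \<xi>z (t + h) z $ i) has_integral \<xi> (t + h) (l i * h) $ i - \<xi> (t + h) 0 $ i) {0..l i * h}"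
      and 2: "((\<lambda>z. \<xi>z (t + h) z $ i) has_integral \<xi> (t + h) (l i * h + z) $ i - \<xi> (t + h) 0 $ i) {0..l i * h + z}"
      using H z lh0 by (auto simp: H1_deriv_def)
    have "((\<lambda>z. \<xi>z (t + h) z $ i) has_integral
        \<xi> (t + h) (z + l i * h) $ i - \<xi> (t + h) (0 + l i * h) $ i) {l i * h..l i * h + z}"
      using has_integral_tail[OF 2 1 lh0] z by (simp add: add.commute)
    also have "\<xi> (t + h) (z + l i * h) $ i - \<xi> (t + h) (0 + l i * h) $ i = \<xi> t z $ i - \<xi> t 0 $ i"
      using characteristics[OF t h, of z i] characteristics[OF t h, of 0 i] z lh0 by simp
    finally have "((\<lambda>z. \<xi>z (t + h) z $ i) has_integral \<xi> t z $ i - \<xi> t 0 $ i) {l i * h..l i * h + z}" .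
    then show ?thesis by (rule has_integral_shift_to_0)
  qed
  have prim': "((\<lambda>z. \<xi>z t z $ i) has_integral (\<xi> t z $ i - \<xi> t 0 $ i)) {0..z}" if "z \<in> {0..1 - l i * h}" for z
    using H1_deriv_vec_nth[OF reg[OF t], of i] that lh0 by (auto simp: H1_deriv_def)
  have end1: "1 - l i * h \<in> {0..1 - l i * h}" using lh[of i] by simp
  from prim[OF end1] prim'[OF end1]
  have int: "(\<lambda>z. \<xi>z (t + h) (l i * h + z) $ i) integrable_on {0..1 - l i * h}"
    "(\<lambda>z. \<xi>z t z $ i) integrable_on {0..1 - l i * h}" by auto
  have "integral {0..z} (\<lambda>z. \<xi>z (t + h) (l i * h + z) $ i) = integral {0..z} (\<lambda>z. \<xi>z t z $ i)"
    if "z \<in> {0..1 - l i * h}" for z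
    using integral_unique[OF prim[OF that]] integral_unique[OF prim'[OF that]] by simp
  from ae_eq_if_integrals_eq[OF int this] obtain N where
    "negligible N" "\<And>z. z \<in> {0..1 - l i * h} - N \<Longrightarrow> \<xi>z (t + h) (l i * h + z) $ i = \<xi>z t z $ i" by blast
  then show ?thesis by (intro that[of N]) (simp_all add: add.commute)
qed

text \<open>The value at \<open>z\<close> entered at time \<open>t + s\<close> with
  \<open>s = h - z / l i\<close>, so component \<open>i\<close> of
  \<open>\<xi> (t + h) z - \<xi> (t + h) 0\<close> is minus the integral of that component of
  \<open>X\<close> over \<open>[s, h]\<close>. Comparing primitives in \<open>z\<close> yields the
  identity, with \<open>1 / l i\<close> from the substitution.\<close>

lemma \<xi>z_inflow:
  obtains N where "negligible N"
    "\<And>z. z \<in> {0..l i * h} - N \<Longrightarrow> \<xi>z (t + h) z $ i = - (X (h - z / l i) $ i / l i)"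
proof -
  have th: "0 \<le> t + h" using t h by simp
  have lh0: "0 \<le> l i * h" using l_pos[of i] h by simp
  have prim: "((\<lambda>z. - (X (h - z / l i) $ i / l i)) has_integral (\<xi> (t + h) z $ i - \<xi> (t + h) 0 $ i)) {0..z}"
    if z: "z \<in> {0..l i * h}" for z
  proof -
    define s where "s = h - z / l i"
    have s: "0 \<le> s" "s \<le> h" using z l_pos[of i] by (auto simp: s_def divide_le_eq mult.commute)
    have hh: "h \<in> {0..h}" and ss: "s \<in> {0..h}" using s h by auto
    have 1: "(X has_integral \<xi> (t + h) 0 - \<xi> t 0) {0..h}" and 2: "(X has_integral \<xi> (t + s) 0 - \<xi> t 0) {0..s}"
      using inflow_primitive[OF hh] inflow_primitive[OF ss] by auto
    have "(X has_integral \<xi> (t + h) 0 - \<xi> (t + s) 0) {s..h}"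
      using has_integral_tail[OF 1 2 s] by simp
    then have "((\<lambda>s. X s $ i) has_integral (\<xi> (t + h) 0 - \<xi> (t + s) 0) $ i) {s..h}"
      by (rule has_integral_vec_nth)
    from has_integral_reflect_affine[OF this _ s(2), of "1 / l i" h]
    have "((\<lambda>z. X (h - z / l i) $ i) has_integral (\<xi> (t + h) 0 $ i - \<xi> (t + s) 0 $ i) * l i) {0..z}"
      using l_pos[of i] by (simp add: s_def mult.commute)
    then have "((\<lambda>z. - (1 / l i) * X (h - z / l i) $ i) has_integral
        - (1 / l i) * ((\<xi> (t + h) 0 $ i - \<xi> (t + s) 0 $ i) * l i)) {0..z}"
      by (rule has_integral_mult_right)
    moreover have "- (1 / l i) * x = - (x / l i)" "- (1 / l i) * ((x - y) * l i) = y - x" for x y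
      by (simp_all add: field_simps)
    ultimately have "((\<lambda>z. - (X (h - z / l i) $ i / l i)) has_integral (\<xi> (t + s) 0 $ i - \<xi> (t + h) 0 $ i)) {0..z}"
      by (simp only:)
    moreover have "\<xi> (t + s + z / l i) (0 + l i * (z / l i)) $ i = \<xi> (t + s) 0 $ i"
      using z lh[of i] t s l_pos[of i] by (intro characteristics) auto
    ultimately show ?thesis by (simp add: s_def)
  qed
  have prim': "((\<lambda>z. \<xi>z (t + h) z $ i) has_integral (\<xi> (t + h) z $ i - \<xi> (t + h) 0 $ i)) {0..z}"
    if "z \<in> {0..l i * h}" for z
    using H1_deriv_vec_nth[OF reg[OF th], of i] that lh[of i] by (auto simp: H1_deriv_def)
  have end1: "l i * h \<in> {0..l i * h}" using lh0 by simp
  from prim[OF end1] prim'[OF end1]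
  have int: "(\<lambda>z. \<xi>z (t + h) z $ i) integrable_on {0..l i * h}"
    "(\<lambda>z. - (X (h - z / l i) $ i / l i)) integrable_on {0..l i * h}" by auto
  have "integral {0..z} (\<lambda>z. \<xi>z (t + h) z $ i) = integral {0..z} (\<lambda>z. - (X (h - z / l i) $ i / l i))"
    if "z \<in> {0..l i * h}" for z
    using integral_unique[OF prim[OF that]] integral_unique[OF prim'[OF that]] by simp
  from ae_eq_if_integrals_eq[OF int this] that show ?thesis by blast
qed

lemma \<xi>z_energy:
  "(\<lambda>s. exp (c * s) * (- (X s $ i / l i))\<^sup>2) integrable_on {0..h}"
  "(\<lambda>s. exp (c * s) * (b s $ i)\<^sup>2) integrable_on {0..h}"
  "exp (c * h) * integral {0..1} (\<lambda>z. exp (- z) * (\<xi>z (t + h) z $ i)\<^sup>2) \<le>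
    integral {0..1} (\<lambda>z. exp (- z) * (\<xi>z t z $ i)\<^sup>2)
    + l i * integral {0..h} (\<lambda>s. exp (c * s) * (- (X s $ i / l i))\<^sup>2)
    - l i * exp (-1) * integral {0..h} (\<lambda>s. exp (c * s) * (b s $ i)\<^sup>2)"
proof -
  have th: "0 \<le> t + h" using t h by simp
  obtain N N' where N: "negligible N"
      "\<And>z. z \<in> {0..1 - l i * h} - N \<Longrightarrow> \<xi>z (t + h) (z + l i * h) $ i = \<xi>z t z $ i"
    and N': "negligible N'"
      "\<And>z. z \<in> {0..l i * h} - N' \<Longrightarrow> \<xi>z (t + h) z $ i = - (X (h - z / l i) $ i / l i)"
    using \<xi>z_outflow \<xi>z_inflow by metis
  note step = transport_energy_step[OF l_pos h lh less_imp_le[OF c_pos] c_le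
      weighted_energy_integrable[OF sq_int(2)[OF t]] weighted_energy_integrable[OF sq_int(2)[OF th]] N N']
  show "(\<lambda>s. exp (c * s) * (- (X s $ i / l i))\<^sup>2) integrable_on {0..h}"
    by (rule step(1))
  show "(\<lambda>s. exp (c * s) * (b s $ i)\<^sup>2) integrable_on {0..h}"
    using step(2) by (simp add: b_def)
  show "exp (c * h) * integral {0..1} (\<lambda>z. exp (- z) * (\<xi>z (t + h) z $ i)\<^sup>2) \<le>
    integral {0..1} (\<lambda>z. exp (- z) * (\<xi>z t z $ i)\<^sup>2)
    + l i * integral {0..h} (\<lambda>s. exp (c * s) * (- (X s $ i / l i))\<^sup>2)
    - l i * exp (-1) * integral {0..h} (\<lambda>s. exp (c * s) * (b s $ i)\<^sup>2)"
    using step(3) by (simp add: b_def)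
qed

end

end

section \<open>From one time window to all times\<close>

context lyapunov_solution
begin

definition Vt :: "real \<Rightarrow> real" where
  "Vt t = energy p1 (\<xi> t) + energy p2 (\<xi>z t) + \<eta> t \<bullet> (P3 *v \<eta> t) + v t \<bullet> (P4 *v v t)"

text \<open>The transport energies contribute inequalities, the ODE states exact identities. Under
  one integral, all boundary and ODE terms combine to \<open>exp (c * s)\<close> times
  \<open>dissipation\<close>, to which the bound by \<open>C\<close> applies.\<close>

lemma lyapunov_step:
  fixes C t h :: real
  assumes t: "0 \<le> t" and h: "0 \<le> h" and lh: "\<And>i. l i * h \<le> 1"
    and C: "\<And>b a e v w. dissipation b a e v w \<le> C * (w \<bullet> w)"
    and wint: "(\<lambda>s. exp (c * s) * (w (t + s) \<bullet> w (t + s))) integrable_on {0..h}"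
  shows "exp (c * h) * Vt (t + h) \<le> Vt t + C * integral {0..h} (\<lambda>s. exp (c * s) * (w (t + s) \<bullet> w (t + s)))"
proof -
  note window = t h lh
  let ?a = "a t" and ?b = "b t" and ?e = "e t" and ?v = "vv t" and ?w = "ww t"
  let ?e' = "e' t" and ?v' = "v' t" and ?X = "X t"
  define A1 A2 B1 B2 where "A1 i = integral {0..h} (\<lambda>s. exp (c * s) * (inflow (?a s) (?e s) (?v s) $ i)\<^sup>2)"
    and "A2 i = integral {0..h} (\<lambda>s. exp (c * s) * (?a s $ i)\<^sup>2)"
    and "B1 i = integral {0..h} (\<lambda>s. exp (c * s) * (- (?X s $ i / l i))\<^sup>2)"
    and "B2 i = integral {0..h} (\<lambda>s. exp (c * s) * (?b s $ i)\<^sup>2)" for i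
  define Q3 where "Q3 = exp (c * h) * (\<eta> (t + h) \<bullet> (P3 *v \<eta> (t + h))) - \<eta> t \<bullet> (P3 *v \<eta> t)"
  define Q4 where "Q4 = exp (c * h) * (v (t + h) \<bullet> (P4 *v v (t + h))) - v t \<bullet> (P4 *v v t)"
  have Q3: "((\<lambda>s. exp (c * s) * (c * (?e s \<bullet> (P3 *v ?e s)) + 2 * (?e s \<bullet> (P3 *v ?e' s)))) has_integral Q3) {0..h}"
    using weighted_quadratic_integral[OF h e_primitive[OF window] e'_bounded[OF window] inner_P3_commute]
    by (simp add: Q3_def e_def[OF window])
  have Q4: "((\<lambda>s. exp (c * s) * (c * (?v s \<bullet> (P4 *v ?v s)) + 2 * (?v s \<bullet> (P4 *v ?v' s)))) has_integral Q4) {0..h}"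
    using weighted_quadratic_integral[OF h v_primitive[OF window] v'_bounded[OF window] inner_P4_commute]
    by (simp add: Q4_def vv_def[OF window])
  define T where "T = (\<Sum>i\<in>UNIV. p1 i * (l i * A1 i - l i * exp (-1) * A2 i))
    + (\<Sum>i\<in>UNIV. p2 i * (l i * B1 i - l i * exp (-1) * B2 i)) + Q3 + Q4"
  have "((\<lambda>s. (\<Sum>i\<in>UNIV. p1 i * (l i * (exp (c * s) * (inflow (?a s) (?e s) (?v s) $ i)\<^sup>2)
        - l i * exp (-1) * (exp (c * s) * (?a s $ i)\<^sup>2)))
      + (\<Sum>i\<in>UNIV. p2 i * (l i * (exp (c * s) * (- (?X s $ i / l i))\<^sup>2)
        - l i * exp (-1) * (exp (c * s) * (?b s $ i)\<^sup>2)))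
      + exp (c * s) * (c * (?e s \<bullet> (P3 *v ?e s)) + 2 * (?e s \<bullet> (P3 *v ?e' s)))
      + exp (c * s) * (c * (?v s \<bullet> (P4 *v ?v s)) + 2 * (?v s \<bullet> (P4 *v ?v' s)))) has_integral T) {0..h}"
    unfolding T_def A1_def A2_def B1_def B2_def
    by (intro has_integral_add has_integral_sum has_integral_diff has_integral_mult_right integrable_integral
        Q3 Q4 \<xi>_energy[OF window] \<xi>z_energy[OF window]) auto
  moreover have "(\<Sum>i\<in>UNIV. p1 i * (l i * (exp (c * s) * (inflow (?a s) (?e s) (?v s) $ i)\<^sup>2)
        - l i * exp (-1) * (exp (c * s) * (?a s $ i)\<^sup>2)))
      + (\<Sum>i\<in>UNIV. p2 i * (l i * (exp (c * s) * (- (?X s $ i / l i))\<^sup>2)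
        - l i * exp (-1) * (exp (c * s) * (?b s $ i)\<^sup>2)))
      + exp (c * s) * (c * (?e s \<bullet> (P3 *v ?e s)) + 2 * (?e s \<bullet> (P3 *v ?e' s)))
      + exp (c * s) * (c * (?v s \<bullet> (P4 *v ?v s)) + 2 * (?v s \<bullet> (P4 *v ?v' s)))
      = exp (c * s) * dissipation (?b s) (?a s) (?e s) (?v s) (?w s)" for s
    unfolding dissipation_def X_def[OF window] e'_def[OF window] v'_def[OF window]
      distrib_left[of "exp (c * s)"] sum_distrib_left
    by (simp only: right_diff_distrib mult_ac)
  ultimately have "((\<lambda>s. exp (c * s) * dissipation (?b s) (?a s) (?e s) (?v s) (?w s)) has_integral T) {0..h}"
    by simp
  then have "T \<le> C * integral {0..h} (\<lambda>s. exp (c * s) * (w (t + s) \<bullet> w (t + s)))"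
  proof (rule has_integral_le[OF _ has_integral_mult_right[OF integrable_integral[OF wint]]])
    show "exp (c * s) * dissipation (?b s) (?a s) (?e s) (?v s) (?w s)
        \<le> C * (exp (c * s) * (w (t + s) \<bullet> w (t + s)))" for s
      using mult_left_mono[OF C[of "?b s" "?a s" "?e s" "?v s" "?w s"], of "exp (c * s)"]
      by (simp add: ww_def[OF window] mult_ac)
  qed
  moreover have "exp (c * h) * energy p1 (\<xi> (t + h))
      \<le> energy p1 (\<xi> t) + (\<Sum>i\<in>UNIV. p1 i * (l i * A1 i - l i * exp (-1) * A2 i))"
    unfolding energy_def sum_distrib_left sum.distrib[symmetric]
  proof (rule sum_mono)
    fix i
    from mult_left_mono[OF \<xi>_energy(3)[OF window, of i] less_imp_le[OF p1_pos[of i]]]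
    show "exp (c * h) * (p1 i * integral {0..1} (\<lambda>z. exp (- z) * (\<xi> (t + h) z $ i)\<^sup>2))
      \<le> p1 i * integral {0..1} (\<lambda>z. exp (- z) * (\<xi> t z $ i)\<^sup>2) + p1 i * (l i * A1 i - l i * exp (-1) * A2 i)"
      unfolding A1_def[symmetric] A2_def[symmetric] by (simp add: algebra_simps)
  qed
  moreover have "exp (c * h) * energy p2 (\<xi>z (t + h))
      \<le> energy p2 (\<xi>z t) + (\<Sum>i\<in>UNIV. p2 i * (l i * B1 i - l i * exp (-1) * B2 i))"
    unfolding energy_def sum_distrib_left sum.distrib[symmetric]
  proof (rule sum_mono)
    fix i
    from mult_left_mono[OF \<xi>z_energy(3)[OF window, of i] less_imp_le[OF p2_pos[of i]]]
    show "exp (c * h) * (p2 i * integral {0..1} (\<lambda>z. exp (- z) * (\<xi>z (t + h) z $ i)\<^sup>2))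
      \<le> p2 i * integral {0..1} (\<lambda>z. exp (- z) * (\<xi>z t z $ i)\<^sup>2) + p2 i * (l i * B1 i - l i * exp (-1) * B2 i)"
      unfolding B1_def[symmetric] B2_def[symmetric] by (simp add: algebra_simps)
  qed
  ultimately show ?thesis
    unfolding Vt_def T_def Q3_def Q4_def by (simp add: algebra_simps)
qed

lemma w_sq_integrable:
  assumes "0 \<le> s" "s \<le> t"
  shows "(\<lambda>\<tau>. w \<tau> \<bullet> w \<tau>) absolutely_integrable_on {0..t}"
    "(\<lambda>\<tau>. exp (c * \<tau>) * (w \<tau> \<bullet> w \<tau>)) integrable_on {s..t}"
proof -
  have "(\<lambda>\<tau>. w \<tau> \<bullet> w \<tau>) absolutely_integrable_on {0<..}"
    using w by (simp add: disturbances_def square_integrable_def)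
  then have "(\<lambda>\<tau>. w \<tau> \<bullet> w \<tau>) absolutely_integrable_on {0<..<t}"
    by (rule set_integrable_subset) auto
  then show W: "(\<lambda>\<tau>. w \<tau> \<bullet> w \<tau>) absolutely_integrable_on {0..t}"
    by (simp add: absolutely_integrable_on_Icc_iff_Ioo)
  have "(\<lambda>\<tau>. exp (c * \<tau>) * (w \<tau> \<bullet> w \<tau>)) absolutely_integrable_on {0..t}"
    by (rule absolutely_integrable_continuous_mult[OF _ W]) (intro continuous_intros)
  then have "(\<lambda>\<tau>. exp (c * \<tau>) * (w \<tau> \<bullet> w \<tau>)) integrable_on {0..t}"
    by (simp add: absolutely_integrable_on_def)
  then show "(\<lambda>\<tau>. exp (c * \<tau>) * (w \<tau> \<bullet> w \<tau>)) integrable_on {s..t}"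
    by (rule integrable_on_subinterval) (use assms in auto)
qed

text \<open>A single step requires \<open>l i * h \<le> 1\<close>, since in a longer one data could
  enter and leave again. Multiplied by \<open>exp (c * t)\<close>, the one-step estimates telescope
  over finitely many windows.\<close>

lemma lyapunov_gronwall:
  assumes C: "\<And>b a e v w. dissipation b a e v w \<le> C * (w \<bullet> w)" and "0 \<le> t"
  shows "exp (c * t) * Vt t \<le> Vt 0 + C * integral {0..t} (\<lambda>s. exp (c * s) * (w s \<bullet> w s))"
proof -
  define W where "W s = exp (c * s) * (w s \<bullet> w s)" for s
  have Wint: "W integrable_on {s..t}" if "0 \<le> s" "s \<le> t" for s t
    using w_sq_integrable(2)[OF that] by (simp add: W_def[abs_def])
  define L where "L = Max (range l)"
  have L: "l i \<le> L" for i by (simp add: L_def)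
  have L_pos: "0 < L" using l_pos L by (rule less_le_trans)
  \<comment> \<open>The crossing time of the fastest component.\<close>
  define h0 where "h0 = 1 / L"
  have h0: "h0 > 0" using L_pos by (simp add: h0_def)
  have step: "exp (c * (t + h)) * Vt (t + h) \<le> exp (c * t) * Vt t + C * integral {t..t + h} W"
    if t: "0 \<le> t" and h: "0 \<le> h" "h \<le> h0" for t h
  proof -
    have lh: "l i * h \<le> 1" for i
      using mult_mono[OF L[of i] h(2)] L_pos h by (simp add: h0_def)
    have W: "((\<lambda>s. W (t + s)) has_integral integral {t..t + h} W) {0..h}"
      using Wint[of t "t + h"] t h by (intro has_integral_shift_to_0 integrable_integral) auto
    from has_integral_mult_right[OF this, of "exp (- (c * t))"]
    have W': "((\<lambda>s. exp (c * s) * (w (t + s) \<bullet> w (t + s))) has_integral exp (- (c * t)) * integral {t..t + h} W) {0..h}"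
      by (simp add: W_def distrib_left exp_add flip: mult.assoc) (simp add: exp_add[symmetric])
    have "exp (c * h) * Vt (t + h) \<le> Vt t + C * integral {0..h} (\<lambda>s. exp (c * s) * (w (t + s) \<bullet> w (t + s)))"
      using W' by (intro lyapunov_step[OF t h(1) lh C]) auto
    then have "exp (c * t) * (exp (c * h) * Vt (t + h))
        \<le> exp (c * t) * (Vt t + C * (exp (- (c * t)) * integral {t..t + h} W))"
      unfolding integral_unique[OF W'] by (intro mult_left_mono) auto
    also have "\<dots> = exp (c * t) * Vt t + C * ((exp (c * t) * exp (- (c * t))) * integral {t..t + h} W)"
      by (simp only: distrib_left mult_ac)
    finally show ?thesis
      by (simp add: exp_minus_inverse distrib_left exp_add)
  qed
  have "exp (c * t) * Vt t \<le> Vt 0 + C * integral {0..t} W" if "0 \<le> t" "t \<le> real n * h0" for n t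
    using that
  proof (induction n arbitrary: t)
    case 0
    then show ?case by simp
  next
    case (Suc n)
    \<comment> \<open>The last window ends at \<open>t\<close> and has length at most
      \<open>h0\<close>; clipping at 0 covers times \<open>t\<close> below
      \<open>h0\<close>.\<close>
    define s where "s = max 0 (t - h0)"
    have s: "0 \<le> s" "s \<le> real n * h0" "s \<le> t" "t - s \<le> h0"
      using Suc.prems h0 by (auto simp: s_def algebra_simps)
    have "exp (c * (s + (t - s))) * Vt (s + (t - s)) \<le> exp (c * s) * Vt s + C * integral {s..s + (t - s)} W"
      using s by (intro step) auto
    also have "\<dots> \<le> Vt 0 + C * integral {0..s} W + C * integral {s..t} W"
      using Suc.IH[OF s(1,2)] by simp
    also have "\<dots> = Vt 0 + C * integral {0..t} W"
      using Henstock_Kurzweil_Integration.integral_combine[OF s(1,3) Wint[of 0 t]] s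
      by (simp flip: distrib_left)
    finally show ?case by simp
  qed
  moreover obtain n where "t \<le> real n * h0"
    using reals_Archimedean3[OF h0] less_imp_le by blast
  ultimately show ?thesis using \<open>0 \<le> t\<close> by (simp add: W_def[abs_def])
qed

end

section \<open>Decay of the Lyapunov functional\<close>

lemma exp_decay_tendsto_0:
  fixes c :: real
  assumes "0 < c"
  shows "((\<lambda>t. exp (- (c * t))) \<longlongrightarrow> 0) at_top"
proof -
  have "filterlim (\<lambda>t. c * t) at_top at_top"
    using assms by (intro filterlim_tendsto_pos_mult_at_top[OF tendsto_const _ filterlim_ident])
  then show ?thesis
    by (intro filterlim_compose[OF exp_at_bot]) (simp add: filterlim_uminus_at_top)
qed

text \<open>Written over a fixed domain, the integrand is \<open>exp (c * x - c * t) * g x\<close>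
  cut off to 0 < x < t: it is dominated by |g| and tends to 0 for each \<open>x\<close>, so
  dominated convergence applies.\<close>

lemma exp_weighted_integral_tendsto_0:
  fixes g :: "real \<Rightarrow> real" and c :: real
  assumes c: "0 < c" and g: "g absolutely_integrable_on {0<..}"
  shows "((\<lambda>t. exp (- (c * t)) * integral {0..t} (\<lambda>s. exp (c * s) * g s)) \<longlongrightarrow> 0) at_top"
proof -
  define G where "G x = indicat_real {0<..} x * g x" for x
  have G: "integrable lebesgue G"
    using g by (simp add: set_integrable_def G_def[abs_def])
  have G_meas: "G \<in> borel_measurable lebesgue"
    using G by (rule borel_measurable_integrable)
  define f where "f t x = indicat_real {0<..<t} x * exp (c * x - c * t) * G x" for t x
  have exp_meas: "(\<lambda>x. exp (c * x - c * t)) \<in> borel_measurable lebesgue" for t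
    using borel_measurable_continuous_onI[of "\<lambda>x. exp (c * x - c * t)"]
    by (intro measurable_completion) (auto intro!: continuous_intros)
  have f_eq: "integral\<^sup>L lebesgue (f t) = exp (- (c * t)) * integral {0..t} (\<lambda>s. exp (c * s) * g s)" for t
  proof -
    have "g absolutely_integrable_on {0<..<t}"
      by (rule set_integrable_subset[OF g]) auto
    then have "(\<lambda>s. exp (c * s) * g s) absolutely_integrable_on {0..t}"
      by (intro absolutely_integrable_continuous_mult continuous_intros)
        (simp add: absolutely_integrable_on_Icc_iff_Ioo)
    then have *: "(\<lambda>s. exp (c * s) * g s) absolutely_integrable_on {0<..<t}"
      by (simp add: absolutely_integrable_on_Icc_iff_Ioo)
    have "f t = (\<lambda>x. exp (- (c * t)) * (indicat_real {0<..<t} x *\<^sub>R (exp (c * x) * g x)))"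
      by (auto simp: f_def G_def fun_eq_iff indicator_def exp_diff exp_minus divide_inverse)
    then have "integral\<^sup>L lebesgue (f t) = exp (- (c * t)) * (LINT x:{0<..<t}|lebesgue. exp (c * x) * g x)"
      by (simp add: set_lebesgue_integral_def)
    then show ?thesis
      by (simp add: set_lebesgue_integral_eq_integral[OF *] integral_open_interval_real)
  qed
  have "((\<lambda>t. integral\<^sup>L lebesgue (f t)) \<longlongrightarrow> integral\<^sup>L lebesgue (\<lambda>x::real. 0)) at_top"
  proof (rule integral_dominated_convergence_at_top)
    show "f t \<in> borel_measurable lebesgue" for t
      unfolding f_def[abs_def] by (intro borel_measurable_times borel_measurable_indicator exp_meas G_meas) auto
    show "integrable lebesgue (\<lambda>x. \<bar>G x\<bar>)" using G by simp
    show "AE x in lebesgue. ((\<lambda>t. f t x) \<longlongrightarrow> 0) at_top"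
    proof (rule AE_I2)
      fix x
      have "((\<lambda>t. exp (c * x) * exp (- (c * t))) \<longlongrightarrow> exp (c * x) * 0) at_top"
        by (intro tendsto_intros exp_decay_tendsto_0 c)
      then have "((\<lambda>t. exp (c * x - c * t)) \<longlongrightarrow> 0) at_top"
        by (simp add: exp_diff exp_minus divide_inverse)
      then have "((\<lambda>t. exp (c * x - c * t) * \<bar>G x\<bar>) \<longlongrightarrow> 0) at_top"
        by (rule tendsto_mult_left_zero)
      then show "((\<lambda>t. f t x) \<longlongrightarrow> 0) at_top"
        by (rule Lim_null_comparison[rotated]) (auto simp: f_def abs_mult indicator_def)
    qed
    show "\<forall>\<^sub>F t in at_top. AE x in lebesgue. norm (f t x) \<le> \<bar>G x\<bar>"
      using c by (intro always_eventually allI AE_I2)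
        (auto simp: f_def abs_mult indicator_def intro!: mult_left_le_one_le)
  qed simp
  then show ?thesis by (simp add: f_eq)
qed

section \<open>Comparison of the functional with the norm\<close>

text \<open>Two uses of \<open>quadratic_form_le\<close> with the two forms exchanged; both vanish
  only at 0, so its negativity condition holds vacuously.\<close>

lemma pos_def_bounds:
  fixes P :: "real^'m^'m"
  assumes "pos_def P"
  obtains m K where "0 < m" "0 < K" "\<And>x. m * (x \<bullet> x) \<le> x \<bullet> (P *v x)" "\<And>x. x \<bullet> (P *v x) \<le> K * (x \<bullet> x)"
proof -
  have cont: "continuous_on UNIV (\<lambda>x. x \<bullet> (P *v x))" "continuous_on UNIV (\<lambda>x::real^'m. x \<bullet> x)"
    by (intro continuous_intros)+
  have hom: "(x *\<^sub>R z) \<bullet> (P *v (x *\<^sub>R z)) = x\<^sup>2 * (z \<bullet> (P *v z))" "(x *\<^sub>R z) \<bullet> (x *\<^sub>R z) = x\<^sup>2 * (z \<bullet> z)"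
    for x and z :: "real^'m"
    by (simp_all add: matrix_vector_mult_scaleR power2_eq_square)
  have pos: "0 < x \<bullet> (P *v x)" if "x \<noteq> 0" for x
    using assms that by (simp add: pos_def_def)
  have nn: "0 \<le> x \<bullet> (P *v x)" for x
    using pos[of x] by (cases "x = 0") auto
  obtain C where C: "C > 0" "\<And>z. z \<bullet> z \<le> C * (z \<bullet> (P *v z))"
    using quadratic_form_le[OF cont(2,1) hom(2,1) nn] pos by force
  obtain K where K: "K > 0" "\<And>z. z \<bullet> (P *v z) \<le> K * (z \<bullet> z)"
    using quadratic_form_le[OF cont hom inner_ge_zero] by auto
  have "1 / C * (z \<bullet> z) \<le> z \<bullet> (P *v z)" for z
    using C(2)[of z] C(1) by (simp add: divide_le_eq mult.commute)
  then show ?thesis using that[of "1 / C" K] C(1) K by auto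
qed

text \<open>On the unit interval the weight lies between exp(-1) and 1, so the bounds for
  \<open>P\<close> pass to the integral.\<close>

lemma energy_bounds:
  fixes P :: "real^'n^'n"
  assumes "diagonal_matrix P" "pos_def P"
  obtains m K where "0 < m" "0 < K"
    "\<And>f. square_integrable {0..1} f \<Longrightarrow> m * (L2_norm f)\<^sup>2 \<le> energy (\<lambda>i. P $ i $ i) f"
    "\<And>f. square_integrable {0..1} f \<Longrightarrow> energy (\<lambda>i. P $ i $ i) f \<le> K * (L2_norm f)\<^sup>2"
proof -
  obtain m K where mK: "0 < m" "0 < K" "\<And>x. m * (x \<bullet> x) \<le> x \<bullet> (P *v x)" "\<And>x. x \<bullet> (P *v x) \<le> K * (x \<bullet> x)"
    using pos_def_bounds[OF assms(2)] by metis
  have lo: "exp (-1) * m * (L2_norm f)\<^sup>2 \<le> energy (\<lambda>i. P $ i $ i) f"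
    and hi: "energy (\<lambda>i. P $ i $ i) f \<le> K * (L2_norm f)\<^sup>2"
    if f: "square_integrable {0..1} f" for f
  proof -
    have "(\<lambda>z. f z \<bullet> f z) integrable_on {0..1}"
      using f by (simp add: square_integrable_def absolutely_integrable_on_def)
    then have int: "((\<lambda>z. f z \<bullet> f z) has_integral (L2_norm f)\<^sup>2) {0..1}"
      unfolding L2_norm_eq_integral[OF f]
      by (simp add: integral_nonneg integrable_integral)
    note energy = weighted_diagonal_integral[OF assms(1) f]
    show "exp (-1) * m * (L2_norm f)\<^sup>2 \<le> energy (\<lambda>i. P $ i $ i) f"
    proof (rule has_integral_le[OF has_integral_mult_right[OF int] energy])
      fix z :: real assume "z \<in> {0..1}"
      then show "exp (-1) * m * (f z \<bullet> f z) \<le> exp (- z) * (f z \<bullet> (P *v f z))"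
        using mult_mono[OF _ mK(3)[of "f z"], of "exp (-1)" "exp (- z)"] mK(1) by simp
    qed
    show "energy (\<lambda>i. P $ i $ i) f \<le> K * (L2_norm f)\<^sup>2"
    proof (rule has_integral_le[OF energy has_integral_mult_right[OF int]])
      fix z :: real assume "z \<in> {0..1}"
      then have "exp (- z) * (f z \<bullet> (P *v f z)) \<le> 1 * (K * (f z \<bullet> f z))"
        using mK by (intro mult_mono) (auto intro: order_trans[OF _ mK(3)])
      then show "exp (- z) * (f z \<bullet> (P *v f z)) \<le> K * (f z \<bullet> f z)" by simp
    qed
  qed
  show ?thesis
    by (rule that[of "exp (-1) * m" K]) (use mK lo hi in auto)
qed

lemma X_norm_nonneg: "0 \<le> X_norm f g v e"
  by (simp add: X_norm_def L2_norm_nonneg)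

lemma sup_norm_disturbance:
  assumes w: "w \<in> disturbances" and t: "0 \<le> t"
  shows "w t \<bullet> w t \<le> (sup_norm w)\<^sup>2"
proof -
  have bdd: "bdd_above ((\<lambda>t. w t \<bullet> w t) ` {0..})"
    using w by (intro bdd_aboveI[of _ 1]) (auto simp: disturbances_def)
  then have le: "w t \<bullet> w t \<le> (SUP t\<in>{0..}. w t \<bullet> w t)"
    using t by (intro cSUP_upper) auto
  then have "0 \<le> (SUP t\<in>{0..}. w t \<bullet> w t)" by (rule order_trans[OF inner_ge_zero])
  with le show ?thesis by (simp add: sup_norm_def)
qed

context lyapunov_LMI
begin

lemma V_eq:
  assumes "square_integrable {0..1} f" "square_integrable {0..1} g"
  shows "V P1 P2 P3 P4 f g v \<eta> = energy p1 f + energy p2 g + \<eta> \<bullet> (P3 *v \<eta>) + v \<bullet> (P4 *v v)"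
  unfolding V_def p1_def[abs_def] p2_def[abs_def]
  by (simp add: weighted_diagonal_LINT assms P1_diagonal P1_pos P2_diagonal P2_pos)

lemma V_bounds:
  obtains m K where "0 < m" "0 < K"
    "\<And>f g v \<eta>. square_integrable {0..1} f \<Longrightarrow> square_integrable {0..1} g \<Longrightarrow>
      m * (X_norm f g v \<eta>)\<^sup>2 \<le> V P1 P2 P3 P4 f g v \<eta> \<and> V P1 P2 P3 P4 f g v \<eta> \<le> K * (X_norm f g v \<eta>)\<^sup>2"
proof -
  obtain m1 K1 where 1: "0 < m1" "0 < K1"
    "\<And>f. square_integrable {0..1} f \<Longrightarrow> m1 * (L2_norm f)\<^sup>2 \<le> energy p1 f"
    "\<And>f. square_integrable {0..1} f \<Longrightarrow> energy p1 f \<le> K1 * (L2_norm f)\<^sup>2"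
    using energy_bounds[OF P1_diagonal P1_pos, folded p1_def[abs_def]] by metis
  obtain m2 K2 where 2: "0 < m2" "0 < K2"
    "\<And>f. square_integrable {0..1} f \<Longrightarrow> m2 * (L2_norm f)\<^sup>2 \<le> energy p2 f"
    "\<And>f. square_integrable {0..1} f \<Longrightarrow> energy p2 f \<le> K2 * (L2_norm f)\<^sup>2"
    using energy_bounds[OF P2_diagonal P2_pos, folded p2_def[abs_def]] by metis
  obtain m3 K3 where 3: "0 < m3" "0 < K3"
    "\<And>x. m3 * (x \<bullet> x) \<le> x \<bullet> (P3 *v x)" "\<And>x. x \<bullet> (P3 *v x) \<le> K3 * (x \<bullet> x)"
    using pos_def_bounds[OF P3_pos] by metis
  obtain m4 K4 where 4: "0 < m4" "0 < K4"
    "\<And>x. m4 * (x \<bullet> x) \<le> x \<bullet> (P4 *v x)" "\<And>x. x \<bullet> (P4 *v x) \<le> K4 * (x \<bullet> x)"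
    using pos_def_bounds[OF P4_pos] by metis
  define m where "m = min (min m1 m2) (min m3 m4)"
  define K where "K = max (max K1 K2) (max K3 K4)"
  have m: "0 < m" "m \<le> m1" "m \<le> m2" "m \<le> m3" "m \<le> m4" using 1 2 3 4 by (auto simp: m_def)
  have K: "0 < K" "K1 \<le> K" "K2 \<le> K" "K3 \<le> K" "K4 \<le> K" using 1 2 3 4 by (auto simp: K_def)
  have "m / 4 * (X_norm f g v \<eta>)\<^sup>2 \<le> V P1 P2 P3 P4 f g v \<eta> \<and> V P1 P2 P3 P4 f g v \<eta> \<le> K * (X_norm f g v \<eta>)\<^sup>2"
    if f: "square_integrable {0..1} f" and g: "square_integrable {0..1} g" for f g v \<eta>
  proof -
    define x y p q where "x = L2_norm f" and "y = L2_norm g" and "p = norm v" and "q = norm \<eta>"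
    have nn: "0 \<le> x" "0 \<le> y" "0 \<le> p" "0 \<le> q"
      by (simp_all add: x_def y_def p_def q_def L2_norm_nonneg)
    have X: "X_norm f g v \<eta> = x + y + p + q" by (simp add: X_norm_def x_def y_def p_def q_def)
    have "m * x\<^sup>2 \<le> energy p1 f" "energy p1 f \<le> K * x\<^sup>2" "m * y\<^sup>2 \<le> energy p2 g" "energy p2 g \<le> K * y\<^sup>2"
      using 1(3,4)[OF f] 2(3,4)[OF g] mult_right_mono[OF m(2) zero_le_power2[of x]]
        mult_right_mono[OF m(3) zero_le_power2[of y]] mult_right_mono[OF K(2) zero_le_power2[of x]]
        mult_right_mono[OF K(3) zero_le_power2[of y]]
      by (simp_all add: x_def y_def)
    moreover have "m * q\<^sup>2 \<le> \<eta> \<bullet> (P3 *v \<eta>)" "\<eta> \<bullet> (P3 *v \<eta>) \<le> K * q\<^sup>2"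
      "m * p\<^sup>2 \<le> v \<bullet> (P4 *v v)" "v \<bullet> (P4 *v v) \<le> K * p\<^sup>2"
      using 3(3,4)[of \<eta>] 4(3,4)[of v] mult_right_mono[OF m(4) zero_le_power2[of q]]
        mult_right_mono[OF m(5) zero_le_power2[of p]] mult_right_mono[OF K(4) zero_le_power2[of q]]
        mult_right_mono[OF K(5) zero_le_power2[of p]]
      by (simp_all add: p_def q_def power2_norm_eq_inner)
    ultimately have V: "m * (x\<^sup>2 + y\<^sup>2 + p\<^sup>2 + q\<^sup>2) \<le> V P1 P2 P3 P4 f g v \<eta>"
      "V P1 P2 P3 P4 f g v \<eta> \<le> K * (x\<^sup>2 + y\<^sup>2 + p\<^sup>2 + q\<^sup>2)"
      unfolding V_eq[OF f g] by (simp_all add: algebra_simps)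
    \<comment> \<open>The norm is a sum of four terms, so Cauchy-Schwarz costs a factor 4, the
      origin of \<open>m / 4\<close>.\<close>
    have "4 * (x\<^sup>2 + y\<^sup>2 + p\<^sup>2 + q\<^sup>2) - (x + y + p + q)\<^sup>2
        = (x - y)\<^sup>2 + (x - p)\<^sup>2 + (x - q)\<^sup>2 + (y - p)\<^sup>2 + (y - q)\<^sup>2 + (p - q)\<^sup>2"
      by (simp add: power2_eq_square algebra_simps)
    then have "(x + y + p + q)\<^sup>2 \<le> 4 * (x\<^sup>2 + y\<^sup>2 + p\<^sup>2 + q\<^sup>2)"
      by (smt (verit) zero_le_power2)
    from mult_left_mono[OF this, of "m / 4"] m(1)
    have lo: "m / 4 * (x + y + p + q)\<^sup>2 \<le> m * (x\<^sup>2 + y\<^sup>2 + p\<^sup>2 + q\<^sup>2)" by simp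
    have "0 \<le> 2 * (x * y + x * p + x * q + y * p + y * q + p * q)"
      using nn by (intro add_nonneg_nonneg mult_nonneg_nonneg) auto
    also have "\<dots> = (x + y + p + q)\<^sup>2 - (x\<^sup>2 + y\<^sup>2 + p\<^sup>2 + q\<^sup>2)"
      by (simp add: power2_eq_square algebra_simps)
    finally have "x\<^sup>2 + y\<^sup>2 + p\<^sup>2 + q\<^sup>2 \<le> (x + y + p + q)\<^sup>2"
      by (simp only: diff_ge_0_iff_ge)
    from mult_left_mono[OF this, of K] K(1)
    have hi: "K * (x\<^sup>2 + y\<^sup>2 + p\<^sup>2 + q\<^sup>2) \<le> K * (x + y + p + q)\<^sup>2" by simp
    show ?thesis using order_trans[OF lo V(1)] order_trans[OF V(2) hi] by (simp add: X)
  qed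
  then show ?thesis using that[of "m / 4" K] m(1) K(1) by simp
qed

section \<open>Exponential ISS and the ultimate bound\<close>

text \<open>The constant \<open>C\<close> is chosen before the solution and the disturbance, as the
  uniform gains in \<open>exp_ISS\<close> require. The two conclusions differ only in how the
  weighted integral of \<open>w s \<bullet> w s\<close> is estimated.\<close>

lemma V_decay:
  "\<exists>C>0. \<forall>w \<xi> \<xi>z v \<eta>. is_solution w \<xi> \<xi>z v \<eta> \<longrightarrow> w \<in> disturbances \<longrightarrow> (\<forall>t\<ge>0.
      V P1 P2 P3 P4 (\<xi> t) (\<xi>z t) (v t) (\<eta> t) \<le> exp (- (c * t)) * V P1 P2 P3 P4 (\<xi> 0) (\<xi>z 0) (v 0) (\<eta> 0)
        + C * (exp (- (c * t)) * integral {0..t} (\<lambda>s. exp (c * s) * (w s \<bullet> w s))))"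
proof -
  obtain C where C: "0 < C" "\<And>b a e v w. dissipation b a e v w \<le> C * (w \<bullet> w)"
    using dissipation_le by metis
  have "V P1 P2 P3 P4 (\<xi> t) (\<xi>z t) (v t) (\<eta> t) \<le> exp (- (c * t)) * V P1 P2 P3 P4 (\<xi> 0) (\<xi>z 0) (v 0) (\<eta> 0)
        + C * (exp (- (c * t)) * integral {0..t} (\<lambda>s. exp (c * s) * (w s \<bullet> w s)))"
    if sol: "is_solution w \<xi> \<xi>z v \<eta>" and w: "w \<in> disturbances" and t: "0 \<le> t" for w \<xi> \<xi>z v \<eta> t
  proof -
    interpret s: lyapunov_solution \<Lambda> H Bu Bv M Bw Dv K1 K2 R S P1 P2 P3 P4 lam \<alpha> \<beta> w \<xi> \<xi>z v \<eta>
      using sol w by unfold_locales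
    have V: "V P1 P2 P3 P4 (\<xi> t) (\<xi>z t) (v t) (\<eta> t) = s.Vt t" if "0 \<le> t" for t
      using V_eq s.sq_int[OF that] by (simp add: s.Vt_def)
    have "s.Vt t = exp (- (c * t)) * (exp (c * t) * s.Vt t)"
      by (simp add: mult.assoc[symmetric] exp_add[symmetric])
    also have "\<dots> \<le> exp (- (c * t)) * (s.Vt 0 + C * integral {0..t} (\<lambda>s. exp (c * s) * (w s \<bullet> w s)))"
      using s.lyapunov_gronwall[OF C(2) t] by (intro mult_left_mono) auto
    finally show ?thesis
      using t by (simp add: V distrib_left mult.left_commute)
  qed
  with C(1) show ?thesis by (intro exI[of _ C]) simp
qed

lemma exp_ISS_disturbances: "exp_ISS disturbances"
proof -
  obtain m K where mK: "0 < m" "0 < K"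
    "\<And>f g v \<eta>. square_integrable {0..1} f \<Longrightarrow> square_integrable {0..1} g \<Longrightarrow>
      m * (X_norm f g v \<eta>)\<^sup>2 \<le> V P1 P2 P3 P4 f g v \<eta> \<and> V P1 P2 P3 P4 f g v \<eta> \<le> K * (X_norm f g v \<eta>)\<^sup>2"
    using V_bounds by metis
  obtain C where C: "0 < C"
    "\<And>w \<xi> \<xi>z v \<eta> t. is_solution w \<xi> \<xi>z v \<eta> \<Longrightarrow> w \<in> disturbances \<Longrightarrow> 0 \<le> t \<Longrightarrow>
      V P1 P2 P3 P4 (\<xi> t) (\<xi>z t) (v t) (\<eta> t) \<le> exp (- (c * t)) * V P1 P2 P3 P4 (\<xi> 0) (\<xi>z 0) (v 0) (\<eta> 0)
        + C * (exp (- (c * t)) * integral {0..t} (\<lambda>s. exp (c * s) * (w s \<bullet> w s)))"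
    using V_decay by blast
  \<comment> \<open>\<open>V\<close> is comparable to the squared norm, so taking roots halves the
    rate to \<open>c / 2\<close>. The ratio \<open>K / m\<close> compares initial and current norm,
    and \<open>1 / c\<close> comes from integrating \<open>exp (c * s)\<close>.\<close>
  define \<rho> \<sigma> where "\<rho> = sqrt (K / m)" and "\<sigma> = sqrt (C / (c * m))"
  have pos: "0 < \<rho>" "0 < \<sigma>" using mK C c_pos by (auto simp: \<rho>_def \<sigma>_def)
  have "X_norm (\<xi> t) (\<xi>z t) (v t) (\<eta> t)
      \<le> \<rho> * exp (- (c / 2) * t) * X_norm (\<xi> 0) (\<xi>z 0) (v 0) (\<eta> 0) + \<sigma> * sup_norm w"
    if w: "w \<in> disturbances" and sol: "is_solution w \<xi> \<xi>z v \<eta>" and t: "0 \<le> t" for w \<xi> \<xi>z v \<eta> t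
  proof -
    interpret s: lyapunov_solution \<Lambda> H Bu Bv M Bw Dv K1 K2 R S P1 P2 P3 P4 lam \<alpha> \<beta> w \<xi> \<xi>z v \<eta>
      using sol w by unfold_locales
    define X X0 N where "X = X_norm (\<xi> t) (\<xi>z t) (v t) (\<eta> t)" and "X0 = X_norm (\<xi> 0) (\<xi>z 0) (v 0) (\<eta> 0)"
      and "N = sup_norm w"
    have N: "0 \<le> N"
    proof -
      have "0 \<le> (SUP t\<in>{0..}. w t \<bullet> w t)"
        using w by (intro cSUP_upper2[of _ _ 0]) (auto intro!: bdd_aboveI[of _ 1] simp: disturbances_def)
      then show ?thesis by (simp add: N_def sup_norm_def)
    qed
    have expint: "((\<lambda>s. exp (c * s)) has_integral (exp (c * t) / c - exp (c * 0) / c)) {0..t}"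
      using t c_pos by (intro fundamental_theorem_of_calculus)
        (auto intro!: derivative_eq_intros simp flip: has_real_derivative_iff_has_vector_derivative)
    have "integral {0..t} (\<lambda>s. exp (c * s) * (w s \<bullet> w s)) \<le> (exp (c * t) / c - exp (c * 0) / c) * N\<^sup>2"
    proof (rule has_integral_le[OF integrable_integral has_integral_mult_left[OF expint]])
      show "(\<lambda>s. exp (c * s) * (w s \<bullet> w s)) integrable_on {0..t}"
        using s.w_sq_integrable(2) t by blast
      show "exp (c * s) * (w s \<bullet> w s) \<le> exp (c * s) * N\<^sup>2" if "s \<in> {0..t}" for s
        using sup_norm_disturbance[OF w, of s] that by (simp add: N_def)
    qed
    also have "\<dots> \<le> exp (c * t) / c * N\<^sup>2" using c_pos by (intro mult_right_mono) auto
    finally have "exp (- (c * t)) * integral {0..t} (\<lambda>s. exp (c * s) * (w s \<bullet> w s))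
        \<le> exp (- (c * t)) * (exp (c * t) / c * N\<^sup>2)" by (intro mult_left_mono) auto
    also have "\<dots> = N\<^sup>2 / c" by (simp add: exp_minus)
    finally have I: "C * (exp (- (c * t)) * integral {0..t} (\<lambda>s. exp (c * s) * (w s \<bullet> w s))) \<le> C * (N\<^sup>2 / c)"
      using C(1) by (intro mult_left_mono) auto
    have "m * X\<^sup>2 \<le> V P1 P2 P3 P4 (\<xi> t) (\<xi>z t) (v t) (\<eta> t)"
      using mK(3) s.sq_int[OF t] by (simp add: X_def)
    also have "\<dots> \<le> exp (- (c * t)) * V P1 P2 P3 P4 (\<xi> 0) (\<xi>z 0) (v 0) (\<eta> 0) + C * (N\<^sup>2 / c)"
      using C(2)[OF sol w t] I by linarith
    also have "\<dots> \<le> exp (- (c * t)) * (K * X0\<^sup>2) + C * (N\<^sup>2 / c)"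
      using mK(3) s.sq_int[of 0] by (intro add_right_mono mult_left_mono) (auto simp: X0_def)
    finally have "X\<^sup>2 \<le> (exp (- (c * t)) * (K * X0\<^sup>2) + C * (N\<^sup>2 / c)) / m"
      using mK(1) by (simp add: le_divide_eq mult.commute)
    also have "\<dots> = (\<rho> * exp (- (c / 2) * t) * X0)\<^sup>2 + (\<sigma> * N)\<^sup>2"
    proof -
      have "(exp (- (c / 2) * t))\<^sup>2 = exp (- (c * t))"
        by (simp add: exp_double[symmetric] power2_eq_square exp_add[symmetric])
      then show ?thesis
        using mK C(1) c_pos by (simp add: power_mult_distrib \<rho>_def \<sigma>_def add_divide_distrib)
    qed
    \<comment> \<open>For nonnegative terms the sum of squares is at most the square of the sum, so
      the root can be taken termwise.\<close>
    also have "\<dots> \<le> (\<rho> * exp (- (c / 2) * t) * X0 + \<sigma> * N)\<^sup>2"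
      using pos N X_norm_nonneg[of "\<xi> 0" "\<xi>z 0" "v 0" "\<eta> 0"]
      unfolding X0_def by (simp add: power2_sum mult_nonneg_nonneg del: mult_minus_left)
    finally show ?thesis
      using pos N X_norm_nonneg unfolding X_def X0_def N_def
      by (elim power2_le_imp_le) (auto intro!: add_nonneg_nonneg mult_nonneg_nonneg)
  qed
  then show ?thesis
    unfolding exp_ISS_def using pos c_pos by (intro exI[of _ "c / 2"] conjI exI[of _ \<rho>] exI[of _ \<sigma>]) auto
qed

text \<open>The trajectory eventually lies in the set: once \<open>V\<close> is at most 1, the state
  itself is the witness, at distance 0.\<close>

lemma ultimate_bound_estimate_disturbances: "ultimate_bound_estimate disturbances (ultimate_set P1 P2 P3 P4)"
  unfolding ultimate_bound_estimate_def
proof (intro ballI allI impI, elim conjE)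
  fix w \<xi> \<xi>z v \<eta> and \<epsilon> :: real
  assume w: "w \<in> disturbances" and sol: "is_solution w \<xi> \<xi>z v \<eta>" and \<epsilon>: "0 < \<epsilon>"
  interpret s: lyapunov_solution \<Lambda> H Bu Bv M Bw Dv K1 K2 R S P1 P2 P3 P4 lam \<alpha> \<beta> w \<xi> \<xi>z v \<eta>
    using sol w by unfold_locales
  obtain C where C: "0 < C" "\<And>t. 0 \<le> t \<Longrightarrow>
      V P1 P2 P3 P4 (\<xi> t) (\<xi>z t) (v t) (\<eta> t) \<le> exp (- (c * t)) * V P1 P2 P3 P4 (\<xi> 0) (\<xi>z 0) (v 0) (\<eta> 0)
        + C * (exp (- (c * t)) * integral {0..t} (\<lambda>s. exp (c * s) * (w s \<bullet> w s)))"
    using V_decay sol w by blast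
  have "(\<lambda>s. w s \<bullet> w s) absolutely_integrable_on {0<..}"
    using w by (simp add: disturbances_def square_integrable_def)
  note lim1 = exp_weighted_integral_tendsto_0[OF c_pos this]
  have "((\<lambda>t. exp (- (c * t)) * V P1 P2 P3 P4 (\<xi> 0) (\<xi>z 0) (v 0) (\<eta> 0)
        + C * (exp (- (c * t)) * integral {0..t} (\<lambda>s. exp (c * s) * (w s \<bullet> w s))))
      \<longlongrightarrow> 0 * V P1 P2 P3 P4 (\<xi> 0) (\<xi>z 0) (v 0) (\<eta> 0) + C * 0) at_top"
    by (intro tendsto_intros lim1 exp_decay_tendsto_0 c_pos)
  then have "\<forall>\<^sub>F t in at_top. exp (- (c * t)) * V P1 P2 P3 P4 (\<xi> 0) (\<xi>z 0) (v 0) (\<eta> 0)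
        + C * (exp (- (c * t)) * integral {0..t} (\<lambda>s. exp (c * s) * (w s \<bullet> w s))) < 1"
    by (rule order_tendstoD) simp
  then have "\<forall>\<^sub>F t in at_top. 0 \<le> t \<and> V P1 P2 P3 P4 (\<xi> t) (\<xi>z t) (v t) (\<eta> t) \<le> 1"
    using eventually_ge_at_top[of 0] by eventually_elim (use C(2) in force)
  then show "\<forall>\<^sub>F t in at_top. \<exists>(f, fz, p, q)\<in>ultimate_set P1 P2 P3 P4.
      X_norm (\<lambda>z. \<xi> t z - f z) (\<lambda>z. \<xi>z t z - fz z) (v t - p) (\<eta> t - q) < \<epsilon>"
  proof eventually_elim
    case (elim t)
    have "X_norm (\<lambda>z. \<xi> t z - \<xi> t z) (\<lambda>z. \<xi>z t z - \<xi>z t z) (v t - v t) (\<eta> t - \<eta> t) < \<epsilon>"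
      using \<epsilon> by (simp add: X_norm_def L2_norm_def)
    moreover have "(\<xi> t, \<xi>z t, v t, \<eta> t) \<in> ultimate_set P1 P2 P3 P4"
      using elim s.reg by (simp add: ultimate_set_def)
    ultimately show ?case by (intro bexI[of _ "(\<xi> t, \<xi>z t, v t, \<eta> t)"]) auto
  qed
qed

end

theorem theorem1:
  fixes \<Lambda> :: "real^'n^'n"
    and H :: "real^'n^'n"
    and Bu :: "real^'u^'n"
    and Bv :: "real^'v^'n"
    and M :: "real^'v^'v"
    and Bw :: "real^'w^'v"
    and Dv :: "real^'v^'n"
    and K1 :: "real^'e^'u"
    and K2 :: "real^'n^'u"
    and R :: "real^'e^'e"
    and S :: "real^'n^'e"
    and P1 P2 :: "real^'n^'n"
    and P3 :: "real^'e^'e"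
    and P4 :: "real^'v^'v"
    and lam \<alpha> \<beta> :: real
  assumes "diagonal_matrix \<Lambda>" and "pos_def \<Lambda>"
    and "hurwitz M"
    and "is_smallest_eigenvalue \<Lambda> lam"
    and "\<alpha> > 0" and "\<beta> > 0"
    and "2 * \<alpha> + \<beta> \<le> exp (-1) * lam"
    and "diagonal_matrix P1" and "pos_def P1"
    and "diagonal_matrix P2" and "pos_def P2"
    and "pos_def P3" and "pos_def P4"
    and "neg_def (coupled_system.LMI_matrix \<Lambda> H Bu Bv M Bw Dv K1 K2 R S P1 P2 P3 P4 \<alpha> \<beta>)"
  shows "coupled_system.exp_ISS \<Lambda> H Bu Bv M Bw Dv K1 K2 R S disturbances \<and>
    coupled_system.ultimate_bound_estimate \<Lambda> H Bu Bv M Bw Dv K1 K2 R S disturbances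
      (ultimate_set P1 P2 P3 P4)"
proof -
  interpret lyapunov_LMI \<Lambda> H Bu Bv M Bw Dv K1 K2 R S P1 P2 P3 P4 lam \<alpha> \<beta>
    using assms by unfold_locales
  show ?thesis
    using exp_ISS_disturbances ultimate_bound_estimate_disturbances by blast
qed

end
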